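(* Let $(\mathfrak{g},B)$ be a solvable odd quadratic Lie superalgebra of dimension 6. If $\mathfrak{g}_{\overline 0}$ is Abelian, then $[\mathfrak{g}_{\overline 0},\mathfrak{g}_{\overline 1}]=\{0\}$ (so the only possibly nonzero brackets are $[\mathfrak{g}_{\overline 1},\mathfrak{g}_{\overline 1}]\subset\mathfrak{g}_{\overline 0}$). If $\mathfrak{g}_{\overline 0}$ is non-Abelian, then $\mathfrak{g}$ is i-isomorphic to one of the following odd quadratic Lie superalgebras with even basis $\{X_{\overline 0},Y_{\overline 0},Z_{\overline 0}\}$, odd basis $\{X_{\overline 1},Y_{\overline 1},Z_{\overline 1}\}$, form $B(X_{\overline 0},X_{\overline 1})=B(Y_{\overline 0},Y_{\overline 1})=B(Z_{\overline 0},Z_{\overline 1})=1$ (zero on other pairs of basis vectors), and nonzero brackets: (2) $\mathfrak{g}^o_{6,2}$: $[X_{\overline 0},Y_{\overline 0}]=Z_{\overline 0}$, $[Y_{\overline 0},Z_{\overline 1}]=X_{\overline 1}$, $[X_{\overline 0},Z_{\overline 1}]=-Y_{\overline 1}$; (3) $\mathfrak{g}^o_{6,3}$: $[X_{\overline 0},Y_{\overline 0}]=Z_{\overline 0}$, $[Y_{\overline 0},Z_{\overline 1}]=X_{\overline 1}$, $[X_{\overline 0},Z_{\overline 1}]=-Y_{\overline 1}$, $[Z_{\overline 1},Z_{\overline 1}]=Z_{\overline 0}$; (4) $\mathfrak{g}^o_{6,4}$: $[X_{\overline 0},Y_{\overline 0}]=Y_{\overline 0}$, $[X_{\overline 0},Z_{\overline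 0}]=Y_{\overline 0}+Z_{\overline 0}$, $[X_{\overline 0},Y_{\overline 1}]=-Y_{\overline 1}-Z_{\overline 1}$, $[Y_{\overline 0},Y_{\overline 1}]=X_{\overline 1}$, $[Z_{\overline 0},Y_{\overline 1}]=X_{\overline 1}$, $[X_{\overline 0},Z_{\overline 1}]=-Z_{\overline 1}$, $[Z_{\overline 0},Z_{\overline 1}]=X_{\overline 1}$; (5) $\mathfrak{g}^o_{6,5}$: $[X_{\overline 0},Y_{\overline 0}]=Y_{\overline 0}$, $[X_{\overline 0},Y_{\overline 1}]=-Y_{\overline 1}$, $[Y_{\overline 0},Y_{\overline 1}]=X_{\overline 1}$, $[Z_{\overline 1},Z_{\overline 1}]=\gamma Z_{\overline 0}$, for some $\gamma\in\mathbb{C}$; (6) $\mathfrak{g}^o_{6,6}$: $[X_{\overline 0},Y_{\overline 0}]=Y_{\overline 0}$, $[X_{\overline 0},Z_{\overline 0}]=\mu Z_{\overline 0}$, $[X_{\overline 0},Y_{\overline 1}]=-Y_{\overline 1}$, $[Y_{\overline 0},Y_{\overline 1}]=X_{\overline 1}$, $[X_{\overline 0},Z_{\overline 1}]=-\mu Z_{\overline 1}$, $[Z_{\overline 0},Z_{\overline 1}]=\mu X_{\overline 1}$, for some $\mu\in\mathbb{C}$ with $\mu\ne0$, $|\mu|\le1$; (7) $\mathfrak{g}^o_{6,7}$: $[X_{\overline 0},Y_{\overline 0}]=Y_{\overline 0}$, $[X_{\overline 0},Z_{\overline 0}]=-\frac12Z_{\overline 0}$, $[X_{\overline 0},Y_{\overline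 1}]=-Y_{\overline 1}$, $[Y_{\overline 0},Y_{\overline 1}]=X_{\overline 1}$, $[X_{\overline 0},Z_{\overline 1}]=\frac12Z_{\overline 1}$, $[Z_{\overline 0},Z_{\overline 1}]=-\frac12X_{\overline 1}$, $[Z_{\overline 1},Z_{\overline 1}]=Y_{\overline 0}$, $[Z_{\overline 1},Y_{\overline 1}]=Z_{\overline 0}$. Moreover, $\mathfrak{g}^o_{6,i}$ is indecomposable for $i\in\{2,3,4,6,7\}$.
   Context: All vector spaces are finite-dimensional over $\mathbb{C}$. An odd quadratic Lie superalgebra is a Lie superalgebra $\mathfrak{g}=\mathfrak{g}_{\overline 0}\oplus\mathfrak{g}_{\overline 1}$ with a non-degenerate bilinear form $B$ that is supersymmetric ($B(Y,X)=(-1)^{xy}B(X,Y)$ for $X\in\mathfrak{g}_x$, $Y\in\mathfrak{g}_y$), invariant ($B([X,Y],Z)=B(X,[Y,Z])$), and odd ($B(\mathfrak{g}_\alpha,\mathfrak{g}_\alpha)=0$ for $\alpha\in\mathbb{Z}_2$). It is indecomposable if $\mathfrak{g}=\mathfrak{g}_1\oplus\mathfrak{g}_2$ with $\mathfrak{g}_1,\mathfrak{g}_2$ $B$-orthogonal (graded) ideals implies $\mathfrak{g}_1=\{0\}$ or $\mathfrak{g}_2=\{0\}$. An i-isomorphism is an (even) Lie superalgebra isomorphism preserving the bilinear forms. Brackets are listed up to super skew-symmetry. *)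

theory Defs
  imports "HOL-Analysis.Cartesian_Space" "HOL-Library.Z2"
begin

text \<open>Gradings are by the field \<^typ>\<open>bit\<close>, i.e. by the integers modulo 2, with 0 for even and 1 for
  odd. The superalgebra is the whole type \<^typ>\<open>'v\<close>, regarded as a complex vector space through
  \<^term>\<open>smult\<close>.\<close>

definition koszul :: "bit \<Rightarrow> bit \<Rightarrow> complex" where
  "koszul x y = (if x * y = 1 then - 1 else 1)"

locale lie_superalgebra = vector_space smult
  for smult :: "complex \<Rightarrow> 'v::ab_group_add \<Rightarrow> 'v" +
  fixes g :: "bit \<Rightarrow> 'v set"
    and br :: "'v \<Rightarrow> 'v \<Rightarrow> 'v"
  assumes fin_dim: "\<exists>S. finite S \<and> span S = UNIV"
    and subspace_g: "subspace (g x)"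
    and g_inter: "g 0 \<inter> g 1 = {0}"
    and g_sum: "\<exists>a\<in>g 0. \<exists>b\<in>g 1. v = a + b"
    and br_linear_right: "Vector_Spaces.linear smult smult (\<lambda>Y. br X Y)"
    and br_linear_left: "Vector_Spaces.linear smult smult (\<lambda>X. br X Y)"
    and br_graded: "X \<in> g x \<Longrightarrow> Y \<in> g y \<Longrightarrow> br X Y \<in> g (x + y)"
    and super_skew: "X \<in> g x \<Longrightarrow> Y \<in> g y \<Longrightarrow> br Y X = - smult (koszul x y) (br X Y)"
    and super_jacobi: "X \<in> g x \<Longrightarrow> Y \<in> g y \<Longrightarrow> Z \<in> g z \<Longrightarrow>
          br X (br Y Z) = br (br X Y) Z + smult (koszul x y) (br Y (br X Z))"
begin

definition br_sets :: "'v set \<Rightarrow> 'v set \<Rightarrow> 'v set" where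
  "br_sets S T = span {br X Y | X Y. X \<in> S \<and> Y \<in> T}"

primrec derived :: "nat \<Rightarrow> 'v set" where
  "derived 0 = UNIV"
| "derived (Suc n) = br_sets (derived n) (derived n)"

definition solvable :: bool where
  "solvable \<longleftrightarrow> (\<exists>n. derived n = {0})"

definition graded_ideal :: "'v set \<Rightarrow> bool" where
  "graded_ideal I \<longleftrightarrow> subspace I \<and>
     (\<forall>v\<in>I. \<exists>a\<in>I \<inter> g 0. \<exists>b\<in>I \<inter> g 1. v = a + b) \<and>
     (\<forall>X. \<forall>Y\<in>I. br X Y \<in> I)"

end

locale odd_quadratic_lie_superalgebra = lie_superalgebra smult g br
  for smult :: "complex \<Rightarrow> 'v::ab_group_add \<Rightarrow> 'v"
    and g :: "bit \<Rightarrow> 'v set"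
    and br :: "'v \<Rightarrow> 'v \<Rightarrow> 'v" +
  fixes B :: "'v \<Rightarrow> 'v \<Rightarrow> complex"
  assumes B_linear_right: "Vector_Spaces.linear smult (*) (\<lambda>Y. B X Y)"
    and B_linear_left: "Vector_Spaces.linear smult (*) (\<lambda>X. B X Y)"
    and B_nondegenerate: "(\<And>Y. B X Y = 0) \<Longrightarrow> X = 0"
    and B_supersymmetric: "X \<in> g x \<Longrightarrow> Y \<in> g y \<Longrightarrow> B Y X = koszul x y * B X Y"
    and B_invariant: "B (br X Y) Z = B X (br Y Z)"
    and B_odd: "X \<in> g x \<Longrightarrow> Y \<in> g x \<Longrightarrow> B X Y = 0"
begin

definition indecomposable :: bool where
  "indecomposable \<longleftrightarrow>
     (\<forall>I J. graded_ideal I \<and> graded_ideal J \<and>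
            I \<inter> J = {0} \<and> (\<forall>v. \<exists>a\<in>I. \<exists>b\<in>J. v = a + b) \<and>
            (\<forall>a\<in>I. \<forall>b\<in>J. B a b = 0)
        \<longrightarrow> I = {0} \<or> J = {0})"

end

definition i_isomorphic ::
  "(complex \<Rightarrow> 'v::ab_group_add \<Rightarrow> 'v) \<Rightarrow> (bit \<Rightarrow> 'v set) \<Rightarrow> ('v \<Rightarrow> 'v \<Rightarrow> 'v) \<Rightarrow> ('v \<Rightarrow> 'v \<Rightarrow> complex) \<Rightarrow>
   (complex \<Rightarrow> 'w::ab_group_add \<Rightarrow> 'w) \<Rightarrow> (bit \<Rightarrow> 'w set) \<Rightarrow> ('w \<Rightarrow> 'w \<Rightarrow> 'w) \<Rightarrow> ('w \<Rightarrow> 'w \<Rightarrow> complex) \<Rightarrow>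
   bool" where
  "i_isomorphic smult g br B smult' g' br' B' \<longleftrightarrow>
     (\<exists>f. Vector_Spaces.linear smult smult' f \<and> bij f \<and>
          (\<forall>x. f ` g x = g' x) \<and>
          (\<forall>X Y. f (br X Y) = br' (f X) (f Y)) \<and>
          (\<forall>X Y. B' (f X) (f Y) = B X Y))"

datatype basis6 = X0 | Y0 | Z0 | X1 | Y1 | Z1

lemma UNIV_basis6: "UNIV = {X0, Y0, Z0, X1, Y1, Z1}"
  using basis6.exhaust by blast

instance basis6 :: finite
  by standard (simp add: UNIV_basis6)

type_synonym space6 = "complex ^ basis6"

abbreviation bas :: "basis6 \<Rightarrow> space6" where
  "bas i \<equiv> axis i 1"

fun parity :: "basis6 \<Rightarrow> bit" where
  "parity X0 = 0" | "parity Y0 = 0" | "parity Z0 = 0"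
| "parity X1 = 1" | "parity Y1 = 1" | "parity Z1 = 1"

definition part6 :: "bit \<Rightarrow> space6 set" where
  "part6 x = {v. \<forall>i. parity i \<noteq> x \<longrightarrow> v $ i = 0}"

definition form6 :: "space6 \<Rightarrow> space6 \<Rightarrow> complex" where
  "form6 v w = v $ X0 * w $ X1 + v $ X1 * w $ X0
             + v $ Y0 * w $ Y1 + v $ Y1 * w $ Y0
             + v $ Z0 * w $ Z1 + v $ Z1 * w $ Z0"

text \<open>A table lists triples \<open>(i, j, v)\<close> meaning that the bracket of the basis vectors \<open>bas i\<close> and \<open>bas j\<close>
  is \<open>v\<close>. It is completed by super skew-symmetry, with all remaining brackets zero. No table below
  has two entries for the same unordered pair.\<close>

type_synonym bracket_table = "(basis6 \<times> basis6 \<times> space6) list"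

definition basis_bracket :: "bracket_table \<Rightarrow> basis6 \<Rightarrow> basis6 \<Rightarrow> space6" where
  "basis_bracket T i j =
     (\<Sum>(a, b, v)\<leftarrow>T. if i = a \<and> j = b then v
                   else if i = b \<and> j = a then - (koszul (parity a) (parity b) *s v)
                   else 0)"

definition bracket6 :: "bracket_table \<Rightarrow> space6 \<Rightarrow> space6 \<Rightarrow> space6" where
  "bracket6 T v w = (\<Sum>i\<in>UNIV. \<Sum>j\<in>UNIV. (v $ i * w $ j) *s basis_bracket T i j)"

definition go62 :: bracket_table where
  "go62 = [(X0, Y0, bas Z0), (Y0, Z1, bas X1), (X0, Z1, - bas Y1)]"

definition go63 :: bracket_table where
  "go63 = [(X0, Y0, bas Z0), (Y0, Z1, bas X1), (X0, Z1, - bas Y1), (Z1, Z1, bas Z0)]"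

definition go64 :: bracket_table where
  "go64 = [(X0, Y0, bas Y0), (X0, Z0, bas Y0 + bas Z0), (X0, Y1, - bas Y1 - bas Z1),
           (Y0, Y1, bas X1), (Z0, Y1, bas X1), (X0, Z1, - bas Z1), (Z0, Z1, bas X1)]"

definition go65 :: "complex \<Rightarrow> bracket_table" where
  "go65 \<gamma> = [(X0, Y0, bas Y0), (X0, Y1, - bas Y1), (Y0, Y1, bas X1), (Z1, Z1, \<gamma> *s bas Z0)]"

definition go66 :: "complex \<Rightarrow> bracket_table" where
  "go66 \<mu> = [(X0, Y0, bas Y0), (X0, Z0, \<mu> *s bas Z0), (X0, Y1, - bas Y1), (Y0, Y1, bas X1),
             (X0, Z1, - (\<mu> *s bas Z1)), (Z0, Z1, \<mu> *s bas X1)]"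

definition go67 :: bracket_table where
  "go67 = [(X0, Y0, bas Y0), (X0, Z0, - (1/2) *s bas Z0), (X0, Y1, - bas Y1), (Y0, Y1, bas X1),
           (X0, Z1, (1/2) *s bas Z1), (Z0, Z1, - (1/2) *s bas X1),
           (Z1, Z1, bas Y0), (Z1, Y1, bas Z0)]"

abbreviation odd_quadratic6 :: "bracket_table \<Rightarrow> bool" where
  "odd_quadratic6 T \<equiv> odd_quadratic_lie_superalgebra (*s) part6 (bracket6 T) form6"

abbreviation indecomposable6 :: "bracket_table \<Rightarrow> bool" where
  "indecomposable6 T \<equiv> odd_quadratic_lie_superalgebra.indecomposable (*s) part6 (bracket6 T) form6"

end

theory Submission
  imports Defs
begin

text \<open>The odd form identifies the odd part with the dual of the even part. Invariance then says that
  the even part acts on the odd part by the coadjoint representation, and that the bracket of two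
  odd elements is the polarisation of a cubic form, which the Jacobi identity forces to be
  invariant. So the algebra is determined by a 3-dimensional solvable Lie algebra together with an
  invariant element of its third symmetric power. The Lie algebra has an abelian ideal of dimension
  2, and the Jordan form of the action of a complementary vector on it leaves three types. Among the
  monomials of degree 3, invariance leaves at most one: \<open>z\<^sup>3\<close> for the Heisenberg algebra and for
  eigenvalues \<open>1, 0\<close>, and \<open>yz\<^sup>2\<close> for eigenvalues \<open>1, -1/2\<close>. Rescaling the basis makes its coefficient
  1; only for eigenvalues \<open>1, 0\<close> is the coefficient kept, as the parameter \<open>\<gamma>\<close>.\<close>

section \<open>Sign rules and linearity of the bracket\<close>

lemma koszul_simps [simp]: "koszul 0 x = 1" "koszul x 0 = 1" "koszul 1 1 = -1"
  by (simp_all add: koszul_def)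

context lie_superalgebra
begin

lemma
  br_add_right: "br X (Y + Z) = br X Y + br X Z" and
  br_scale_right: "br X (smult c Y) = smult c (br X Y)" and
  br_add_left: "br (X + Y) Z = br X Z + br Y Z" and
  br_scale_left: "br (smult c X) Y = smult c (br X Y)"
  using br_linear_right[of X] br_linear_left[of Y] br_linear_left[of Z]
  by (simp_all add: Vector_Spaces.linear_iff)

lemma br_zero_right [simp]: "br X 0 = 0"
  using br_scale_right[of X 0 0] by simp

lemma br_zero_left [simp]: "br 0 X = 0"
  using br_scale_left[of 0 0 X] by simp

lemma br_minus_right: "br X (- Y) = - br X Y"
  using br_scale_right[of X "-1" Y] by simp

lemma br_minus_left: "br (- X) Y = - br X Y"
  using br_scale_left[of "-1" X Y] by simp

lemma br_diff_right: "br X (Y - Z) = br X Y - br X Z"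
  using br_add_right[of X Y "- Z"] by (simp add: br_minus_right)

lemma br_diff_left: "br (X - Y) Z = br X Z - br Y Z"
  using br_add_left[of X "- Y" Z] by (simp add: br_minus_left)

lemmas br_linear_simps = br_add_right br_add_left br_diff_right br_diff_left
  br_minus_right br_minus_left br_scale_right br_scale_left

lemma g_zero [simp]: "0 \<in> g x"
  by (simp add: subspace_0 subspace_g)

lemma g_add: "X \<in> g x \<Longrightarrow> Y \<in> g x \<Longrightarrow> X + Y \<in> g x"
  by (simp add: subspace_add subspace_g)

lemma g_scale: "X \<in> g x \<Longrightarrow> smult c X \<in> g x"
  by (simp add: subspace_scale subspace_g)

lemma g_diff: "X \<in> g x \<Longrightarrow> Y \<in> g x \<Longrightarrow> X - Y \<in> g x"
  by (simp add: subspace_diff subspace_g)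

lemma g_minus: "X \<in> g x \<Longrightarrow> - X \<in> g x"
  by (simp add: subspace_neg subspace_g)

lemmas g_closed = g_add g_scale g_diff g_minus

lemma br_in_g:
  "X \<in> g 0 \<Longrightarrow> Y \<in> g x \<Longrightarrow> br X Y \<in> g x"
  "X \<in> g 1 \<Longrightarrow> Y \<in> g 0 \<Longrightarrow> br X Y \<in> g 1"
  "X \<in> g 1 \<Longrightarrow> Y \<in> g 1 \<Longrightarrow> br X Y \<in> g 0"
  using br_graded[of X 0 Y x] br_graded[of X 1 Y 0] br_graded[of X 1 Y 1]
  by (cases "x = 0", simp_all)

lemma br_skew:
  "X \<in> g 0 \<Longrightarrow> Y \<in> g x \<Longrightarrow> br Y X = - br X Y"
  "X \<in> g 1 \<Longrightarrow> Y \<in> g 1 \<Longrightarrow> br Y X = br X Y"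
  using super_skew[of X 0 Y x] super_skew[of X 1 Y 1] by simp_all

lemma br_self_even [simp]: "X \<in> g 0 \<Longrightarrow> br X X = 0"
proof -
  assume "X \<in> g 0"
  then have "br X X + br X X = 0"
    using br_skew(1)[of X X 0] by (metis add.right_inverse)
  then have "smult 2 (br X X) = 0"
    by (metis one_add_one scale_left_distrib scale_one)
  then show ?thesis by simp
qed

lemma jacobi_even:
  "X \<in> g 0 \<Longrightarrow> Y \<in> g y \<Longrightarrow> Z \<in> g z \<Longrightarrow> br X (br Y Z) = br (br X Y) Z + br Y (br X Z)"
  using super_jacobi[of X 0 Y y Z z] by simp

lemma g_sumE:
  obtains a b where "a \<in> g 0" "b \<in> g 1" "v = a + b"
  using g_sum[of v] by blast

lemma br_sets_eq_0_iff: "br_sets S T = {0} \<longleftrightarrow> (\<forall>X\<in>S. \<forall>Y\<in>T. br X Y = 0)"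
proof
  assume "br_sets S T = {0}"
  moreover have "br X Y \<in> br_sets S T" if "X \<in> S" "Y \<in> T" for X Y
    unfolding br_sets_def using that by (intro span_base) blast
  ultimately show "\<forall>X\<in>S. \<forall>Y\<in>T. br X Y = 0" by blast
next
  assume "\<forall>X\<in>S. \<forall>Y\<in>T. br X Y = 0"
  then have "br_sets S T \<subseteq> {0}"
    unfolding br_sets_def by (intro span_minimal) auto
  then show "br_sets S T = {0}"
    using span_zero unfolding br_sets_def by blast
qed

end

section \<open>The odd form\<close>

context odd_quadratic_lie_superalgebra
begin

lemma
  B_add_right: "B X (Y + Z) = B X Y + B X Z" and
  B_scale_right: "B X (smult c Y) = c * B X Y" and
  B_add_left: "B (X + Y) Z = B X Z + B Y Z" and
  B_scale_left: "B (smult c X) Y = c * B X Y"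
  using B_linear_right[of X] B_linear_left[of Y] B_linear_left[of Z]
  by (simp_all add: Vector_Spaces.linear_iff)

lemma B_zero_right [simp]: "B X 0 = 0"
  using B_scale_right[of X 0 0] by simp

lemma B_zero_left [simp]: "B 0 X = 0"
  using B_scale_left[of 0 0 X] by simp

lemma B_minus_right: "B X (- Y) = - B X Y"
  using B_scale_right[of X "-1" Y] by simp

lemma B_minus_left: "B (- X) Y = - B X Y"
  using B_scale_left[of "-1" X Y] by simp

lemma B_diff_right: "B X (Y - Z) = B X Y - B X Z"
  using B_add_right[of X Y "- Z"] by (simp add: B_minus_right)

lemma B_diff_left: "B (X - Y) Z = B X Z - B Y Z"
  using B_add_left[of X "- Y" Z] by (simp add: B_minus_left)

lemmas B_linear_simps = B_add_right B_add_left B_diff_right B_diff_left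
  B_minus_right B_minus_left B_scale_right B_scale_left

lemma B_sum_left: "B (sum h A) X = (\<Sum>i\<in>A. B (h i) X)"
  by (induction A rule: infinite_finite_induct) (simp_all add: B_add_left)

text \<open>The sign in supersymmetry differs from 1 only for two odd arguments, and there oddness
  makes the form vanish.\<close>

lemma B_commute: "B X Y = B Y X"
proof -
  have *: "B b a = B a b" if "a \<in> g 0" "b \<in> g 1" for a b
    using B_supersymmetric[OF that] by simp
  obtain a b where X: "a \<in> g 0" "b \<in> g 1" "X = a + b" by (rule g_sumE)
  obtain c d where Y: "c \<in> g 0" "d \<in> g 1" "Y = c + d" by (rule g_sumE)
  show ?thesis
    using X Y *[of a d] *[of c b] B_odd[of a 0 c] B_odd[of c 0 a] B_odd[of b 1 d] B_odd[of d 1 b]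
    by (simp add: B_linear_simps)
qed

lemma eq_if_B_eq: "X = Y" if "\<And>Z. B X Z = B Y Z"
  using B_nondegenerate[of "X - Y"] that by (simp add: B_diff_left)

text \<open>Oddness removes the odd component of a test vector, so even test vectors already
  separate the odd part.\<close>

lemma odd_eq_if_B_eq:
  assumes "X \<in> g 1" "Y \<in> g 1" "\<And>Z. Z \<in> g 0 \<Longrightarrow> B X Z = B Y Z"
  shows "X = Y"
proof (rule eq_if_B_eq)
  fix Z
  obtain a b where "a \<in> g 0" "b \<in> g 1" "Z = a + b" by (rule g_sumE)
  with assms show "B X Z = B Y Z"
    using B_odd[of X 1 b] B_odd[of Y 1 b] by (simp add: B_linear_simps)
qed

text \<open>Symmetry and invariance give \<open>B (br X Y) Z = B (br Z X) Y\<close>, where the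
  bracket on the right is one of even elements.\<close>

lemma br_even_odd_eq_0_if_abelian:
  assumes "\<And>X Y. X \<in> g 0 \<Longrightarrow> Y \<in> g 0 \<Longrightarrow> br X Y = 0" and "X \<in> g 0" "Y \<in> g 1"
  shows "br X Y = 0"
proof (rule odd_eq_if_B_eq)
  fix Z assume Z: "Z \<in> g 0"
  have "B (br X Y) Z = B Z (br X Y)" by (rule B_commute)
  also have "\<dots> = B (br Z X) Y" by (simp add: B_invariant)
  finally show "B (br X Y) Z = B 0 Z" using assms Z by simp
qed (use assms in \<open>auto intro: br_in_g\<close>)

subsection \<open>Dual systems\<close>

text \<open>A partial hyperbolic basis, kept as a set of pairs so that matching of dual vectors is
  equality of pairs and enlarging is \<open>insert\<close>.\<close>

definition dual_system :: "('v \<times> 'v) set \<Rightarrow> bool" where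
  "dual_system P \<longleftrightarrow> finite P \<and> P \<subseteq> g 0 \<times> g 1 \<and>
     (\<forall>p\<in>P. \<forall>q\<in>P. B (fst p) (snd q) = (if p = q then 1 else 0))"

lemma dual_systemD:
  assumes "dual_system P"
  shows "finite P"
    and "p \<in> P \<Longrightarrow> fst p \<in> g 0" "p \<in> P \<Longrightarrow> snd p \<in> g 1"
    and "p \<in> P \<Longrightarrow> q \<in> P \<Longrightarrow> B (fst p) (snd q) = (if p = q then 1 else 0)"
    and "p \<in> P \<Longrightarrow> q \<in> P \<Longrightarrow> B (snd p) (fst q) = (if p = q then 1 else 0)"
    and "p \<in> P \<Longrightarrow> q \<in> P \<Longrightarrow> B (fst p) (fst q) = 0"
    and "p \<in> P \<Longrightarrow> q \<in> P \<Longrightarrow> B (snd p) (snd q) = 0"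
proof -
  show *: "finite P" "p \<in> P \<Longrightarrow> fst p \<in> g 0" "p \<in> P \<Longrightarrow> snd p \<in> g 1"
    "p \<in> P \<Longrightarrow> q \<in> P \<Longrightarrow> B (fst p) (snd q) = (if p = q then 1 else 0)" for p q
    using assms by (force simp: dual_system_def)+
  show "p \<in> P \<Longrightarrow> q \<in> P \<Longrightarrow> B (snd p) (fst q) = (if p = q then 1 else 0)"
    using *(4)[of q p] B_commute[of "snd p" "fst q"] by auto
  show "p \<in> P \<Longrightarrow> q \<in> P \<Longrightarrow> B (fst p) (fst q) = 0"
    "p \<in> P \<Longrightarrow> q \<in> P \<Longrightarrow> B (snd p) (snd q) = 0"
    using *(2,3) B_odd by blast+
qed

text \<open>Each vector has a partner that pairs to 1 with it and to 0 with all the others, so it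
  cannot lie in the span of the others.\<close>

lemma dual_system_independent:
  assumes "dual_system P"
  shows "independent (fst ` P \<union> snd ` P)" "card (fst ` P \<union> snd ` P) = 2 * card P"
proof -
  note D = dual_systemD[OF assms]
  have inj: "inj_on fst P" "inj_on snd P"
    by (rule inj_onI, metis D(4) zero_neq_one)+
  have "fst p \<noteq> snd q" if "p \<in> P" "q \<in> P" for p q
    using D(4)[of p p] D(7)[of q p] that by auto
  then have "fst ` P \<inter> snd ` P = {}" by blast
  then show "card (fst ` P \<union> snd ` P) = 2 * card P"
    using D(1) inj by (simp add: card_Un_disjoint card_image)
  have key: "\<exists>x'. B x x' = 1 \<and> (\<forall>y\<in>(fst ` P \<union> snd ` P) - {x}. B y x' = 0)"
    if x: "x \<in> fst ` P \<union> snd ` P" for x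
  proof -
    obtain p x' where p: "p \<in> P" "(x = fst p \<and> x' = snd p) \<or> (x = snd p \<and> x' = fst p)"
      using x by blast
    have "B y x' = 0" if y: "y \<in> (fst ` P \<union> snd ` P) - {x}" for y
    proof -
      obtain q where q: "q \<in> P" "y = fst q \<or> y = snd q" "y \<noteq> x" using y by blast
      then show ?thesis
        using p D(4)[OF q(1) p(1)] D(5)[OF q(1) p(1)] D(6)[OF q(1) p(1)] D(7)[OF q(1) p(1)]
        by (cases "p = q") auto
    qed
    moreover have "B x x' = 1" using p D(4)[OF p(1) p(1)] D(5)[OF p(1) p(1)] by auto
    ultimately show ?thesis by blast
  qed
  show "independent (fst ` P \<union> snd ` P)"
    unfolding dependent_def
  proof (intro notI, elim bexE)
    fix x assume x: "x \<in> fst ` P \<union> snd ` P" and span: "x \<in> span (fst ` P \<union> snd ` P - {x})"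
    obtain x' where x': "B x x' = 1" "\<forall>y\<in>(fst ` P \<union> snd ` P) - {x}. B y x' = 0"
      using key[OF x] by blast
    have "B x x' = 0"
      using span by (rule span_induct_alt) (use x'(2) in \<open>auto simp: B_linear_simps\<close>)
    with x' show False by simp
  qed
qed

text \<open>A hyperbolic Gram-Schmidt step: a vector outside the span yields one orthogonal to the
  system, non-degeneracy provides a partner, and homogeneous components of the two form the new
  pair.\<close>

lemma dual_system_extend:
  assumes P: "dual_system P" and ne: "span (fst ` P \<union> snd ` P) \<noteq> UNIV"
  shows "\<exists>p. p \<notin> P \<and> dual_system (insert p P)"
proof -
  note D = dual_systemD[OF P]
  define S where "S = fst ` P \<union> snd ` P"
  \<comment> \<open>Orthogonal projection onto the span: the coefficient of each vector is the
    pairing with its partner.\<close>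
  define proj where
    "proj v = (\<Sum>p\<in>P. smult (B v (snd p)) (fst p) + smult (B v (fst p)) (snd p))" for v
  have orth: "B (v - proj v) s = 0" if s: "s \<in> S" for v s
  proof -
    obtain q where q: "q \<in> P" "s = fst q \<or> s = snd q"
      using s unfolding S_def by blast
    then have "(\<Sum>p\<in>P. B v (snd p) * B (fst p) s + B v (fst p) * B (snd p) s)
        = (\<Sum>p\<in>P. if p = q then B v s else 0)"
      by (intro sum.cong) (elim disjE; simp add: D)+
    then show ?thesis
      using q D(1) by (simp add: proj_def B_linear_simps B_sum_left)
  qed
  \<comment> \<open>Hence replacing \<open>y\<close> by \<open>y - proj y\<close> will not change
    its pairing with \<open>v - proj v\<close>.\<close>
  have B_proj: "B w (proj v) = 0" if "\<And>s. s \<in> S \<Longrightarrow> B w s = 0" for w v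
  proof -
    have "B (fst p) w = 0 \<and> B (snd p) w = 0" if "p \<in> P" for p
      using that \<open>\<And>s. s \<in> S \<Longrightarrow> B w s = 0\<close> B_commute[of _ w] unfolding S_def by (metis UnI1 UnI2 image_eqI)
    then have "B (proj v) w = 0"
      by (simp add: proj_def B_sum_left B_linear_simps)
    then show ?thesis using B_commute by metis
  qed
  obtain v where v: "v \<notin> span S" using ne S_def by blast
  have "proj v \<in> span S"
    unfolding proj_def by (intro span_sum span_add span_scale span_base) (auto simp: S_def)
  with v have "v - proj v \<noteq> 0" by auto
  then obtain y where y: "B (v - proj v) y \<noteq> 0" using B_nondegenerate by blast
  obtain a b where ab: "a \<in> g 0" "b \<in> g 1" "v - proj v = a + b" by (rule g_sumE)
  obtain c d where cd: "c \<in> g 0" "d \<in> g 1" "y - proj y = c + d" by (rule g_sumE)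
  \<comment> \<open>Orthogonality passes to homogeneous components: each \<open>s\<close> is
    homogeneous, so oddness already kills one of the two pairings.\<close>
  have parts: "B a s = 0 \<and> B b s = 0"
    if "w - proj w = a + b" "a \<in> g 0" "b \<in> g 1" "s \<in> S" for w a b s
  proof -
    have *: "B a s + B b s = 0"
      using orth[OF that(4), of w] unfolding that(1) by (simp add: B_add_left)
    have "s \<in> g 0 \<or> s \<in> g 1" using that(4) D by (auto simp: S_def)
    then have "B a s = 0 \<or> B b s = 0"
      using that B_odd[of a 0 s] B_odd[of b 1 s] by blast
    then show ?thesis using * by auto
  qed
  have "B (v - proj v) (y - proj y) \<noteq> 0"
    using y B_proj orth by (simp add: B_diff_right)
  then have "B a d + B c b \<noteq> 0"
    unfolding ab cd using ab(1,2) cd(1,2) B_odd[of a 0 c] B_odd[of b 1 d]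
    by (simp add: B_linear_simps B_commute[of b c] add.commute)
  \<comment> \<open>The new pair is \<open>a\<close> with \<open>d\<close>, or \<open>c\<close> with
    \<open>b\<close>, whichever pairs to a nonzero number.\<close>
  then have "B a d \<noteq> 0 \<or> B c b \<noteq> 0" by auto
  then obtain a' b' where a'b': "a' \<in> g 0" "b' \<in> g 1" "B a' b' \<noteq> 0"
    and or': "\<And>s. s \<in> S \<Longrightarrow> B a' s = 0" "\<And>s. s \<in> S \<Longrightarrow> B b' s = 0"
    using ab cd parts[OF ab(3)] parts[OF cd(3)] by metis
  have or'': "B a' (snd p) = 0" "B (fst p) b' = 0" if "p \<in> P" for p
    using that or' B_commute[of "fst p" b'] by (auto simp: S_def)
  define p where "p = (a', smult (1 / B a' b') b')"
  have "p \<notin> P"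
    using D(4)[of p p] or''(1)[of p] by (auto simp: p_def)
  moreover have "dual_system (insert p P)"
    unfolding dual_system_def
  proof (intro conjI ballI)
    show "insert p P \<subseteq> g 0 \<times> g 1"
      using a'b' D by (auto simp: p_def g_closed mem_Times_iff)
    show "B (fst q) (snd r) = (if q = r then 1 else 0)"
      if "q \<in> insert p P" "r \<in> insert p P" for q r
    proof -
      have "B (fst p) (snd p) = 1"
        using a'b'(3) by (simp add: p_def B_scale_right)
      moreover have "B (fst p) (snd r) = 0" if "r \<in> P" using or''(1)[OF that] by (simp add: p_def)
      moreover have "B (fst q) (snd p) = 0" if "q \<in> P"
        using or''(2)[OF that] by (simp add: p_def B_scale_right)
      ultimately show ?thesis using that D(4)[of q r] \<open>p \<notin> P\<close>
        by (cases "q = p"; cases "r = p") auto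
    qed
  qed (use D in simp)
  ultimately show ?thesis by blast
qed

end

section \<open>Dual systems and frames in dimension six\<close>

locale odd_quadratic_dim6 = odd_quadratic_lie_superalgebra smult g br B
  for smult :: "complex \<Rightarrow> 'v::ab_group_add \<Rightarrow> 'v" and g br B +
  assumes dim6: "dim UNIV = 6"
begin

lemma finite_dimensional_basis:
  obtains C where "finite_dimensional_vector_space smult C" "card C = 6"
proof -
  obtain C where C: "independent C" "span C = UNIV" "card C = 6"
    using basis_exists[of UNIV] dim6 by (metis top.extremum_uniqueI)
  moreover have "finite C" using C(3) by (intro card_ge_0_finite) simp
  ultimately have "finite_dimensional_vector_space smult C"
    by unfold_locales
  with C(3) show ?thesis using that by blast
qed

lemma dual_system_complete:
  assumes "dual_system P" "card P = 3"
  shows "span (fst ` P \<union> snd ` P) = UNIV"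
proof -
  obtain C where "finite_dimensional_vector_space smult C" "card C = 6"
    by (rule finite_dimensional_basis)
  then interpret fd: finite_dimensional_vector_space smult C by simp
  show ?thesis
    using fd.card_eq_dim[of "fst ` P \<union> snd ` P" UNIV] dual_system_independent[OF assms(1)]
      dual_systemD(1)[OF assms(1)] assms(2) dim6 by auto
qed

text \<open>Induction on the number \<open>n\<close> of missing pairs: while one is missing, at most
  four vectors are present, and they cannot span.\<close>

lemma dual_system_extend_complete:
  assumes "dual_system P" "card P = 3 - n" "n \<le> 3"
  shows "\<exists>Q. P \<subseteq> Q \<and> dual_system Q \<and> card Q = 3"
  using assms
proof (induction n arbitrary: P)
  case 0
  then show ?case by auto
next
  case (Suc n)
  obtain C where "finite_dimensional_vector_space smult C" "card C = 6"
    by (rule finite_dimensional_basis)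
  then interpret fd: finite_dimensional_vector_space smult C by simp
  have fin: "finite P" using Suc.prems by (simp add: dual_system_def)
  have "span (fst ` P \<union> snd ` P) \<noteq> UNIV"
  proof
    assume "span (fst ` P \<union> snd ` P) = UNIV"
    then have "6 \<le> card (fst ` P \<union> snd ` P)"
      using dim_le_card[of UNIV "fst ` P \<union> snd ` P"] fin dim6 by auto
    then show False using dual_system_independent(2)[OF Suc.prems(1)] Suc.prems by auto
  qed
  then obtain p where p: "p \<notin> P" "dual_system (insert p P)"
    using dual_system_extend Suc.prems(1) by blast
  have "card (insert p P) = 3 - n"
    using p fin Suc.prems by simp
  then show ?case
    using Suc.IH[OF p(2)] Suc.prems by auto
qed

text \<open>A dual system of three pairs with its vectors named. Pairings of equal parity are left
  out because oddness makes them 0.\<close>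

definition frame :: "'v \<Rightarrow> 'v \<Rightarrow> 'v \<Rightarrow> 'v \<Rightarrow> 'v \<Rightarrow> 'v \<Rightarrow> bool" where
  "frame X Y Z X' Y' Z' \<longleftrightarrow>
     X \<in> g 0 \<and> Y \<in> g 0 \<and> Z \<in> g 0 \<and> X' \<in> g 1 \<and> Y' \<in> g 1 \<and> Z' \<in> g 1 \<and>
     B X X' = 1 \<and> B X Y' = 0 \<and> B X Z' = 0 \<and>
     B Y X' = 0 \<and> B Y Y' = 1 \<and> B Y Z' = 0 \<and>
     B Z X' = 0 \<and> B Z Y' = 0 \<and> B Z Z' = 1"

lemma frame_extend:
  assumes "X \<in> g 0" "X' \<in> g 1" "B X X' = 1"
  shows "\<exists>Y Z Y' Z'. frame X Y Z X' Y' Z'"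
proof -
  have "dual_system {(X, X')}" using assms by (simp add: dual_system_def)
  then obtain Q where Q: "(X, X') \<in> Q" "dual_system Q" "card Q = 3"
    using dual_system_extend_complete[of "{(X, X')}" 2] by auto
  then have "card (Q - {(X, X')}) = 2" by (simp add: dual_system_def)
  then obtain p q where pq: "Q - {(X, X')} = {p, q}" "p \<noteq> q" by (auto simp: card_2_iff)
  have mem: "p \<in> Q" "q \<in> Q" "(X, X') \<noteq> p" "(X, X') \<noteq> q" using pq by blast+
  note D = dual_systemD[OF Q(2)]
  have "frame X (fst p) (fst q) X' (snd p) (snd q)"
    using assms D(2,3)[OF mem(1)] D(2,3)[OF mem(2)] D(4)[OF Q(1) mem(1)] D(4)[OF Q(1) mem(2)]
      D(4)[OF mem(1) Q(1)] D(4)[OF mem(2) Q(1)] D(4)[OF mem(1,2)] D(4)[OF mem(2,1)]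
      D(4)[OF mem(1,1)] D(4)[OF mem(2,2)] mem(3,4) pq(2)
    by (simp add: frame_def)
  then show ?thesis by blast
qed

lemma frame_exists: "\<exists>X Y Z X' Y' Z'. frame X Y Z X' Y' Z'"
proof -
  have "dual_system {}" by (simp add: dual_system_def)
  then obtain Q where Q: "dual_system Q" "card Q = 3"
    using dual_system_extend_complete[of "{}" 3] by auto
  then have "Q \<noteq> {}" by auto
  then obtain p where "p \<in> Q" by blast
  then have "fst p \<in> g 0" "snd p \<in> g 1" "B (fst p) (snd p) = 1"
    using dual_systemD[OF Q(1)] by simp_all
  then show ?thesis using frame_extend by blast
qed

lemma frame_span:
  assumes "frame X Y Z X' Y' Z'"
  shows "span {X, Y, Z, X', Y', Z'} = UNIV"
proof -
  let ?P = "{(X, X'), (Y, Y'), (Z, Z')}"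
  have "X \<noteq> Y" "X \<noteq> Z" "Y \<noteq> Z" using assms by (auto simp: frame_def)
  then have "dual_system ?P" "card ?P = 3"
    using assms by (auto simp: frame_def dual_system_def)
  then have "span (fst ` ?P \<union> snd ` ?P) = UNIV" by (rule dual_system_complete)
  moreover have "fst ` ?P \<union> snd ` ?P = {X, Y, Z, X', Y', Z'}" by auto
  ultimately show ?thesis by simp
qed

lemma frame_eqI:
  assumes "frame X Y Z X' Y' Z'" and "\<And>e. e \<in> {X, Y, Z, X', Y', Z'} \<Longrightarrow> B v e = B w e"
  shows "v = w"
proof (rule eq_if_B_eq)
  fix u
  have "u \<in> span {X, Y, Z, X', Y', Z'}" using frame_span[OF assms(1)] by simp
  then have "B (v - w) u = 0"
    by (rule span_induct_alt) (use assms(2) in \<open>auto simp: B_linear_simps\<close>)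
  then show "B v u = B w u" by (simp add: B_linear_simps)
qed

lemma frame_dual:
  assumes "frame X Y Z X' Y' Z'"
  shows "B X' X = 1" "B X' Y = 0" "B X' Z = 0" "B Y' X = 0" "B Y' Y = 1" "B Y' Z = 0"
    "B Z' X = 0" "B Z' Y = 0" "B Z' Z = 1"
    "B X X = 0" "B X Y = 0" "B X Z = 0" "B Y X = 0" "B Y Y = 0" "B Y Z = 0"
    "B Z X = 0" "B Z Y = 0" "B Z Z = 0"
    "B X' X' = 0" "B X' Y' = 0" "B X' Z' = 0" "B Y' X' = 0" "B Y' Y' = 0" "B Y' Z' = 0"
    "B Z' X' = 0" "B Z' Y' = 0" "B Z' Z' = 0"
  using assms B_odd[of _ 0] B_odd[of _ 1] by (simp_all add: frame_def B_commute)

lemma frame_even_eqI: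
  assumes "frame X Y Z X' Y' Z'" "v \<in> g 0" "w \<in> g 0"
    and "B v X' = B w X'" "B v Y' = B w Y'" "B v Z' = B w Z'"
  shows "v = w"
  by (rule frame_eqI[OF assms(1)]) (use assms B_odd[of _ 0] in \<open>auto simp: frame_def\<close>)

lemma frame_odd_eqI:
  assumes "frame X Y Z X' Y' Z'" "v \<in> g 1" "w \<in> g 1"
    and "B v X = B w X" "B v Y = B w Y" "B v Z = B w Z"
  shows "v = w"
  by (rule frame_eqI[OF assms(1)]) (use assms B_odd[of _ 1] in \<open>auto simp: frame_def\<close>)

lemma frame_even_expand:
  assumes F: "frame X Y Z X' Y' Z'" and v: "v \<in> g 0"
  shows "v = smult (B v X') X + smult (B v Y') Y + smult (B v Z') Z"
  by (rule frame_even_eqI[OF F]) (use F v in \<open>auto simp: frame_def B_linear_simps intro!: g_closed\<close>)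

subsection \<open>The Lie algebra structure of the even part\<close>

lemma g0_nontrivial: "g 0 \<noteq> {0}"
  using frame_exists by (force simp: frame_def)

text \<open>A perfect nonzero even part would survive in every term of the derived series of the
  whole algebra.\<close>

lemma br_sets_even_psubset:
  assumes "solvable"
  shows "br_sets (g 0) (g 0) \<subset> g 0"
proof
  show "br_sets (g 0) (g 0) \<subseteq> g 0"
    unfolding br_sets_def by (intro span_minimal subspace_g) (auto intro: br_in_g)
  show "br_sets (g 0) (g 0) \<noteq> g 0"
  proof
    assume perfect: "br_sets (g 0) (g 0) = g 0"
    have "g 0 \<subseteq> derived n" for n
    proof (induction n)
      case (Suc n)
      then have "br_sets (g 0) (g 0) \<subseteq> br_sets (derived n) (derived n)"
        unfolding br_sets_def by (intro span_mono) blast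
      then show ?case using perfect by simp
    qed simp
    then have "g 0 \<subseteq> {0}" using assms unfolding solvable_def by metis
    then show False using g0_nontrivial g_zero by blast
  qed
qed

text \<open>As the derived algebra of the even part is proper, some linear functional vanishes on it
  but not at some even \<open>U\<close>; the form represents it by an odd vector \<open>X'\<close>.
  The plane of \<open>Y\<close> and \<open>Z\<close>, the kernel of \<open>X'\<close> on the even
  part, is then an ideal of codimension 1.\<close>

lemma exists_odd_annihilating_derived:
  assumes "solvable"
  shows "\<exists>X Y Z X' Y' Z'. frame X Y Z X' Y' Z' \<and>
    (\<forall>u\<in>g 0. \<forall>v\<in>g 0. B (br u v) X' = 0)"
proof -
  let ?D = "br_sets (g 0) (g 0)"
  obtain U where U: "U \<in> g 0" "U \<notin> ?D" using br_sets_even_psubset[OF assms] by blast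
  obtain C where C: "C \<subseteq> ?D" "independent C" "?D \<subseteq> span C"
    using maximal_independent_subset by blast
  have D: "subspace ?D" by (simp add: br_sets_def)
  then have "span C = ?D" using C span_minimal by blast
  then have "independent (insert U C)" using U C by (simp add: independent_insertI)
  interpret vp: vector_space_pair smult "(*) :: complex \<Rightarrow> complex \<Rightarrow> complex"
    using B_linear_right[of 0] by (simp add: Vector_Spaces.linear_iff vector_space_pair_def)
  obtain \<phi> where \<phi>: "Vector_Spaces.linear smult (*) \<phi>"
      "\<And>x. x \<in> insert U C \<Longrightarrow> \<phi> x = (if x = U then 1 else 0 :: complex)"
    using vp.linear_independent_extend[OF \<open>independent (insert U C)\<close>,
        of "\<lambda>x. if x = U then 1 else 0"] by blast
  have \<phi>D: "\<phi> x = 0" if "x \<in> ?D" for x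
  proof (rule vp.linear_eq_0_on_span[OF \<phi>(1)])
    show "x \<in> span C" using that C by blast
    show "\<phi> c = 0" if "c \<in> C" for c using \<phi>(2)[of c] that C(1) U(2) by auto
  qed
  obtain X Y Z X' Y' Z' where F: "frame X Y Z X' Y' Z'" using frame_exists by blast
  \<comment> \<open>The odd vector representing \<phi> on the even part: its coefficients are the
    values of \<phi> on the dual even vectors.\<close>
  let ?f = "smult (\<phi> X) X' + smult (\<phi> Y) Y' + smult (\<phi> Z) Z'"
  have f: "B v ?f = \<phi> v" if "v \<in> g 0" for v
  proof -
    have "\<phi> v = \<phi> (smult (B v X') X + smult (B v Y') Y + smult (B v Z') Z)"
      using frame_even_expand[OF F that] by simp
    also have "\<dots> = B v X' * \<phi> X + B v Y' * \<phi> Y + B v Z' * \<phi> Z"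
      using \<phi>(1) by (simp add: Vector_Spaces.linear_iff)
    finally show ?thesis by (simp add: B_linear_simps mult.commute)
  qed
  have "?f \<in> g 1" using F by (simp add: frame_def g_closed)
  moreover have "B U ?f = 1" using f[OF U(1)] \<phi>(2)[of U] by simp
  ultimately obtain Y2 Z2 Y2' Z2' where F2: "frame U Y2 Z2 ?f Y2' Z2'"
    using frame_extend U(1) by blast
  have "B (br u v) ?f = 0" if "u \<in> g 0" "v \<in> g 0" for u v
  proof -
    have "br u v \<in> ?D" unfolding br_sets_def using that by (intro span_base) blast
    then show ?thesis using f[of "br u v"] \<phi>D that by (simp add: br_in_g)
  qed
  then show ?thesis using F2 by blast
qed

text \<open>The odd vectors transform by the inverse transpose, which preserves the pairing.\<close>

lemma frame_change:
  assumes F: "frame X Y Z X' Y' Z'" and "t \<noteq> 0" and det: "p * s - q * r \<noteq> 0"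
  shows "frame (smult t X) (smult p Y + smult q Z) (smult r Y + smult s Z) (smult (1 / t) X')
    (smult (s / (p * s - q * r)) Y' - smult (r / (p * s - q * r)) Z')
    (smult (p / (p * s - q * r)) Z' - smult (q / (p * s - q * r)) Y')"
proof -
  have "p * s / (p * s - q * r) - q * r / (p * s - q * r) = 1"
    using det by (simp flip: diff_divide_distrib)
  then show ?thesis
    using F \<open>t \<noteq> 0\<close> by (simp add: frame_def g_closed B_linear_simps algebra_simps)
qed

lemma frame_even_expand_ker:
  assumes "frame X Y Z X' Y' Z'" "v \<in> g 0" "B v X' = 0"
  shows "v = smult (B v Y') Y + smult (B v Z') Z"
  using frame_even_expand[OF assms(1,2)] assms(3) by (metis add_0 scale_zero_left)

text \<open>The plane of \<open>Y\<close> and \<open>Z\<close> is an abelian ideal of the even part;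
  the rows \<open>(a, b)\<close> and \<open>(c, d)\<close> are the images of \<open>Y\<close> and
  \<open>Z\<close> under \<open>br X\<close>.\<close>

definition adapted ::
  "'v \<Rightarrow> 'v \<Rightarrow> 'v \<Rightarrow> 'v \<Rightarrow> 'v \<Rightarrow> 'v \<Rightarrow> complex \<Rightarrow> complex \<Rightarrow> complex \<Rightarrow> complex \<Rightarrow> bool" where
  "adapted X Y Z X' Y' Z' a b c d \<longleftrightarrow> frame X Y Z X' Y' Z' \<and> br Y Z = 0 \<and>
     br X Y = smult a Y + smult b Z \<and> br X Z = smult c Y + smult d Z"

lemma adapted_if_nonabelian_complement:
  assumes F: "frame X Y Z X' Y' Z'" and perp: "\<And>u v. u \<in> g 0 \<Longrightarrow> v \<in> g 0 \<Longrightarrow> B (br u v) X' = 0"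
    and YZ: "br Y Z = Z"
  shows "\<exists>X Y Z X' Y' Z'. adapted X Y Z X' Y' Z' 1 0 0 0"
proof -
  have mem: "X \<in> g 0" "Y \<in> g 0" "Z \<in> g 0" using F by (auto simp: frame_def)
  \<comment> \<open>The plane spanned by \<open>Y\<close> and \<open>Z\<close> is nonabelian, so all its derivations are inner; correcting \<open>X\<close>
    by an element of the plane gives a central \<open>W\<close>.\<close>
  define a b c d where abcd: "a = B (br X Y) Y'" "b = B (br X Y) Z'"
    "c = B (br X Z) Y'" "d = B (br X Z) Z'"
  have XY: "br X Y = smult a Y + smult b Z" and XZ: "br X Z = smult c Y + smult d Z"
    unfolding abcd by (intro frame_even_expand_ker[OF F] perp br_in_g mem)+
  \<comment> \<open>\<open>br X\<close> acts as a derivation on \<open>br Y Z = Z\<close>. Comparing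
    with \<open>c\<close> and \<open>d\<close> gives \<open>c = 0\<close> and
    \<open>a + d = d\<close>.\<close>
  have "br X Z = smult (a + d) Z"
    using jacobi_even[OF mem] mem
    by (simp add: YZ XY XZ br_linear_simps scale_left_distrib)
  then have "B (br X Z) Y' = B (smult (a + d) Z) Y'" "B (br X Z) Z' = B (smult (a + d) Z) Z'"
    by simp_all
  then have "a = 0" "c = 0"
    using F by (simp_all add: XZ frame_def B_linear_simps)
  define W where "W = X - smult d Y + smult b Z"
  have ZY: "br Z Y = - Z" and YX: "br Y X = - smult b Z" and ZX: "br Z X = - smult d Z"
    using br_skew(1)[of Y Z 0] br_skew(1)[of X Y 0] br_skew(1)[of X Z 0] mem YZ XY XZ
    by (simp_all add: \<open>a = 0\<close> \<open>c = 0\<close>)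
  \<comment> \<open>\<open>Y\<close> takes over the role of \<open>X\<close>, with \<open>Z\<close>
    and the central \<open>W\<close> spanning the abelian ideal; the multiples of \<open>X'\<close>
    compensate for the correction in \<open>W\<close>.\<close>
  have "frame Y Z W (Y' + smult d X') (Z' - smult b X') X'"
    using F by (simp add: frame_def W_def g_closed B_linear_simps)
  moreover have "br Z W = 0" "br Y W = 0"
    using mem by (simp_all add: W_def br_linear_simps ZX ZY YX YZ)
  ultimately have "adapted Y Z W (Y' + smult d X') (Z' - smult b X') X' 1 0 0 0"
    using YZ by (simp add: adapted_def)
  then show ?thesis by blast
qed

text \<open>The type records the matrix of \<open>br X\<close> on an abelian ideal \<open>span {Y, Z}\<close> of the even part. It may be
  conjugated, by changing \<open>Y\<close> and \<open>Z\<close>, and rescaled, by changing \<open>X\<close>.\<close>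

definition has_type :: "complex \<Rightarrow> complex \<Rightarrow> complex \<Rightarrow> complex \<Rightarrow> bool" where
  "has_type a b c d \<longleftrightarrow> (\<exists>X Y Z X' Y' Z'. adapted X Y Z X' Y' Z' a b c d)"

text \<open>The plane of \<open>Y\<close> and \<open>Z\<close> contains all even brackets. If it is
  abelian, it is the ideal sought; otherwise its basis is normalised to
  \<open>br Y Z = Z\<close>.\<close>

lemma has_type_if_solvable:
  assumes "solvable"
  shows "\<exists>a b c d. has_type a b c d"
proof -
  obtain X Y Z X' Y' Z' where F: "frame X Y Z X' Y' Z'"
    and perp: "\<And>u v. u \<in> g 0 \<Longrightarrow> v \<in> g 0 \<Longrightarrow> B (br u v) X' = 0"
    using exists_odd_annihilating_derived[OF assms] by blast
  have mem: "X \<in> g 0" "Y \<in> g 0" "Z \<in> g 0" using F by (auto simp: frame_def)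
  define p q where pq: "p = B (br Y Z) Y'" "q = B (br Y Z) Z'"
  have YZ: "br Y Z = smult p Y + smult q Z"
    unfolding pq by (rule frame_even_expand_ker[OF F br_in_g(1)[OF mem(2,3)] perp[OF mem(2,3)]])
  have ZY: "br Z Y = - br Y Z" by (rule br_skew(1)[OF mem(2,3)])
  consider "p = 0" "q = 0" | "q \<noteq> 0" | "p \<noteq> 0" "q = 0" by blast
  then show ?thesis
  proof cases
    case 1
    then have "adapted X Y Z X' Y' Z' (B (br X Y) Y') (B (br X Y) Z') (B (br X Z) Y') (B (br X Z) Z')"
      using F YZ unfolding adapted_def
      by (intro conjI frame_even_expand_ker[OF F] perp br_in_g mem) simp_all
    then show ?thesis unfolding has_type_def by blast
  next
    case 2
    \<comment> \<open>\<open>?Z\<close> is \<open>br Y Z\<close> itself, and \<open>?Y\<close> makes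
      the determinant of the change 1, so that \<open>br ?Y ?Z = br Y Z\<close>. The same choice is
      made in the next case.\<close>
    let ?Y = "smult (1 / q) Y + smult 0 Z" and ?Z = "smult p Y + smult q Z"
    have "br ?Y ?Z = ?Z"
      using mem 2 by (simp add: br_linear_simps YZ)
    then have "\<exists>X Y Z X' Y' Z'. adapted X Y Z X' Y' Z' 1 0 0 0"
      by (intro adapted_if_nonabelian_complement[OF frame_change[OF F, of 1 "1 / q" q 0 p]])
        (use 2 perp in \<open>simp_all add: B_linear_simps\<close>)
    then show ?thesis unfolding has_type_def by blast
  next
    case 3
    let ?Y = "smult 0 Y + smult (- 1 / p) Z" and ?Z = "smult p Y + smult 0 Z"
    have "br ?Y ?Z = ?Z"
      using mem 3 by (simp add: br_linear_simps YZ ZY)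
    then have "\<exists>X Y Z X' Y' Z'. adapted X Y Z X' Y' Z' 1 0 0 0"
      by (intro adapted_if_nonabelian_complement[OF frame_change[OF F, of 1 0 0 "- 1 / p" p]])
        (use 3 perp in \<open>simp_all add: B_linear_simps\<close>)
    then show ?thesis unfolding has_type_def by blast
  qed
qed

text \<open>With \<open>P\<close> the matrix of rows \<open>(p, q)\<close>, \<open>(r, s)\<close>,
  the equations \<open>eqs\<close> are the entries of \<open>t P M = M' P\<close>: conjugation and
  rescaling, stated without the inverse of \<open>P\<close>.\<close>

lemma has_type_change:
  assumes "has_type a b c d" "t \<noteq> 0" "p * s - q * r \<noteq> 0"
    and eqs: "t * (p * a + q * c) = a' * p + b' * r" "t * (p * b + q * d) = a' * q + b' * s"
      "t * (r * a + s * c) = c' * p + d' * r" "t * (r * b + s * d) = c' * q + d' * s"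
  shows "has_type a' b' c' d'"
proof -
  obtain X Y Z X' Y' Z' where A: "adapted X Y Z X' Y' Z' a b c d"
    using assms(1) by (auto simp: has_type_def)
  then have mem: "X \<in> g 0" "Y \<in> g 0" "Z \<in> g 0" and ZY: "br Z Y = 0"
    using br_skew(1)[of Y Z 0] by (auto simp: adapted_def frame_def)
  let ?Y = "smult p Y + smult q Z" and ?Z = "smult r Y + smult s Z"
  have "br (smult t X) ?Y = smult (t * (p * a + q * c)) Y + smult (t * (p * b + q * d)) Z"
    "br (smult t X) ?Z = smult (t * (r * a + s * c)) Y + smult (t * (r * b + s * d)) Z"
    using A by (simp_all add: adapted_def br_linear_simps scale_right_distrib scale_left_distrib
        algebra_simps)
  then have "br (smult t X) ?Y = smult a' ?Y + smult b' ?Z" "br (smult t X) ?Z = smult c' ?Y + smult d' ?Z"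
    unfolding eqs by (simp_all add: scale_right_distrib scale_left_distrib algebra_simps)
  moreover have "br ?Y ?Z = 0" using A mem ZY by (simp add: adapted_def br_linear_simps)
  ultimately show ?thesis
    using frame_change[OF _ assms(2,3)] A unfolding has_type_def adapted_def by blast
qed

lemma has_type_triangular:
  assumes "has_type a b c d" "(a, b, c, d) \<noteq> (0, 0, 0, 0)"
  shows "\<exists>l c d. has_type l 0 c d \<and> (l, c, d) \<noteq> (0, 0, 0)"
proof (cases "b = 0")
  case True
  then show ?thesis using assms by auto
next
  case False
  \<comment> \<open>An eigenvalue of the matrix, by the quadratic formula.\<close>
  define l where "l = (a + d + csqrt ((a - d)\<^sup>2 + 4 * b * c)) / 2"
  have "(2 * l - (a + d))\<^sup>2 = (a - d)\<^sup>2 + 4 * b * c"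
    unfolding l_def by (simp add: field_simps del: distrib_left_numeral distrib_right_numeral)
  then have "(l - d) * a + b * c = l * (l - d)"
    by algebra
  \<comment> \<open>The row \<open>(l - d, b)\<close> is a left eigenvector for \<open>l\<close> and
    gives the new \<open>Y\<close>; the old \<open>Y\<close> becomes the new \<open>Z\<close>, and
    the trace gives the other eigenvalue.\<close>
  then have "has_type l 0 1 (a + d - l)"
    by (intro has_type_change[OF assms(1), of 1 "l - d" 0 b 1])
      (use False in \<open>simp_all add: algebra_simps\<close>)
  then show ?thesis by (intro exI conjI) auto
qed

text \<open>In order: the nilpotent block (Heisenberg algebra), the Jordan block for eigenvalue 1,
  and the diagonal matrices whose eigenvalue of larger modulus is scaled to 1.\<close>

definition normal_form :: "complex \<Rightarrow> complex \<Rightarrow> complex \<Rightarrow> complex \<Rightarrow> bool" where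
  "normal_form a b c d \<longleftrightarrow> (a, b, c, d) = (0, 1, 0, 0) \<or> (a, b, c, d) = (1, 0, 1, 1) \<or>
     (a, b, c) = (1, 0, 0) \<and> norm d \<le> 1"

text \<open>Distinct eigenvalues are diagonalised by a shear and divided by the one of larger
  modulus, after a swap of \<open>Y\<close> and \<open>Z\<close> if necessary. A double eigenvalue
  gives a scalar matrix or a block, nilpotent or not.\<close>

lemma has_type_normal_form:
  assumes "has_type a b c d" "(a, b, c, d) \<noteq> (0, 0, 0, 0)"
  shows "\<exists>a b c d. has_type a b c d \<and> normal_form a b c d"
proof -
  obtain l c d where T: "has_type l 0 c d" and nz: "(l, c, d) \<noteq> (0, 0, 0)"
    using has_type_triangular[OF assms] by blast
  consider "l \<noteq> d" | "l = d" "c = 0" "l \<noteq> 0" | "l = d" "c \<noteq> 0" "l = 0" | "l = d" "c \<noteq> 0" "l \<noteq> 0"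
    using nz by auto
  then show ?thesis
  proof cases
    case 1
    then have diag: "has_type l 0 0 d"
      by (intro has_type_change[OF T, of 1 1 1 0 "c / (d - l)"]) (simp_all add: field_simps)
    show ?thesis
    proof (cases "norm d \<le> norm l")
      case True
      then have "l \<noteq> 0" using 1 by auto
      then have "has_type 1 0 0 (d / l)"
        by (intro has_type_change[OF diag, of "1 / l" 1 1 0 0]) simp_all
      moreover have "normal_form 1 0 0 (d / l)"
        using True \<open>l \<noteq> 0\<close> by (simp add: normal_form_def norm_divide)
      ultimately show ?thesis by blast
    next
      case False
      then have "d \<noteq> 0" by auto
      then have "has_type 1 0 0 (l / d)"
        by (intro has_type_change[OF diag, of "1 / d" 0 0 1 1]) simp_all
      moreover have "normal_form 1 0 0 (l / d)"
        using False \<open>d \<noteq> 0\<close> by (simp add: normal_form_def norm_divide)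
      ultimately show ?thesis by blast
    qed
  next
    case 2
    then have "has_type 1 0 0 1"
      by (intro has_type_change[OF T, of "1 / l" 1 1 0 0]) simp_all
    then show ?thesis by (force simp: normal_form_def)
  next
    case 3
    then have "has_type 0 1 0 0"
      by (intro has_type_change[OF T, of 1 0 0 1 c]) simp_all
    then show ?thesis by (force simp: normal_form_def)
  next
    case 4
    then have "has_type 1 0 1 1"
      by (intro has_type_change[OF T, of "1 / l" "c / l" 1 0 0]) simp_all
    then show ?thesis by (force simp: normal_form_def)
  qed
qed

subsection \<open>The invariant cubic form on the odd part\<close>

abbreviation cubic :: "'v \<Rightarrow> 'v \<Rightarrow> 'v \<Rightarrow> complex" where
  "cubic f h k \<equiv> B (br f h) k"

text \<open>The bracket of odd elements is symmetric, and invariance carries this symmetry to the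
  last two places; the two transpositions generate all permutations.\<close>

lemma cubic_commute:
  assumes "f \<in> g 1" "h \<in> g 1" "k \<in> g 1"
  shows "cubic f h k = cubic h f k" "cubic f h k = cubic f k h"
proof -
  show *: "cubic f h k = cubic h f k"
    using br_skew(2)[OF assms(1,2)] by simp
  have "cubic f h k = B f (br h k)" by (rule B_invariant)
  also have "\<dots> = B f (br k h)" using br_skew(2)[OF assms(2,3)] by simp
  also have "\<dots> = cubic f k h" by (rule B_invariant[symmetric])
  finally show "cubic f h k = cubic f k h" .
qed

text \<open>By the Jacobi identity an even \<open>x\<close> acts on odd brackets as a derivation,
  and invariance of \<open>B\<close> moves the outer action to \<open>k\<close>.\<close>

lemma cubic_invariant:
  assumes "x \<in> g 0" "f \<in> g 1" "h \<in> g 1" "k \<in> g 1"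
  shows "cubic (br x f) h k + cubic f (br x h) k + cubic f h (br x k) = 0"
proof -
  have "B (br x (br f h)) k = - B (br (br f h) x) k"
    using br_skew(1)[OF assms(1) br_in_g(3)[OF assms(2,3)]] by (simp add: B_minus_left)
  also have "\<dots> = - cubic f h (br x k)" by (simp add: B_invariant)
  finally show ?thesis
    using jacobi_even[OF assms(1-3)] by (simp add: B_add_left)
qed

text \<open>For even \<open>u\<close>, \<open>v\<close> and odd \<open>f\<close> this is the
  coadjoint action: mixed brackets can be read off from the even ones.\<close>

lemma coadjoint: "B (br u f) v = B (br v u) f"
  using B_invariant[of v u f] B_commute[of v "br u f"] by simp

lemma adapted_coadjoint:
  assumes A: "adapted X Y Z X' Y' Z' a b c d"
  shows "br X X' = 0" "br X Y' = - smult a Y' - smult c Z'" "br X Z' = - smult b Y' - smult d Z'"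
    "br Y X' = 0" "br Y Y' = smult a X'" "br Y Z' = smult b X'"
    "br Z X' = 0" "br Z Y' = smult c X'" "br Z Z' = smult d X'"
proof -
  have F: "frame X Y Z X' Y' Z'" using A by (simp add: adapted_def)
  then have mem: "X \<in> g 0" "Y \<in> g 0" "Z \<in> g 0" "X' \<in> g 1" "Y' \<in> g 1" "Z' \<in> g 1"
    by (auto simp: frame_def)
  have br: "br X Y = smult a Y + smult b Z" "br X Z = smult c Y + smult d Z" "br Y Z = 0"
    using A by (auto simp: adapted_def)
  then have br': "br Y X = - (smult a Y + smult b Z)" "br Z X = - (smult c Y + smult d Z)"
    "br Z Y = 0"
    using br_skew(1)[of X Y 0] br_skew(1)[of X Z 0] br_skew(1)[of Y Z 0] mem by simp_all
  show "br X X' = 0" "br X Y' = - smult a Y' - smult c Z'"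
    "br X Z' = - smult b Y' - smult d Z'"
    "br Y X' = 0" "br Y Y' = smult a X'" "br Y Z' = smult b X'"
    "br Z X' = 0" "br Z Y' = smult c X'" "br Z Z' = smult d X'"
    by (rule frame_odd_eqI[OF F]; use F br br' in \<open>simp add: coadjoint[where f = X'] coadjoint[where f = Y']
        coadjoint[where f = Z'] frame_dual[OF F] frame_def B_linear_simps br_in_g g_closed\<close>)+
qed

text \<open>Up to permutation, \<open>cubic\<close> is nonzero on the dual basis at most at
  \<open>Z' Z' Z'\<close>, with value \<gamma>, and at \<open>Y' Z' Z'\<close>, with value
  \<delta>.\<close>

definition adapted_cubic ::
  "'v \<Rightarrow> 'v \<Rightarrow> 'v \<Rightarrow> 'v \<Rightarrow> 'v \<Rightarrow> 'v \<Rightarrow> complex \<Rightarrow> complex \<Rightarrow> complex \<Rightarrow> complex \<Rightarrow>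
   complex \<Rightarrow> complex \<Rightarrow> bool" where
  "adapted_cubic X Y Z X' Y' Z' a b c d \<gamma> \<delta> \<longleftrightarrow> adapted X Y Z X' Y' Z' a b c d \<and>
     br X' X' = 0 \<and> br X' Y' = 0 \<and> br X' Z' = 0 \<and> br Y' Y' = 0 \<and>
     br Y' Z' = smult \<delta> Z \<and> br Z' Z' = smult \<gamma> Z + smult \<delta> Y"

text \<open>Invariance under \<open>Y\<close> and \<open>X\<close> is written out on the dual basis.
  The two equations in the conclusion are invariance under \<open>X\<close> at
  \<open>Z' Z' Z'\<close> and at \<open>Y' Z' Z'\<close>.\<close>

lemma adapted_cubic_if_normal_form:
  assumes A: "adapted X Y Z X' Y' Z' a b c d" and N: "normal_form a b c d"
  shows "\<exists>\<gamma> \<delta>. adapted_cubic X Y Z X' Y' Z' a b c d \<gamma> \<delta> \<and>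
    b * \<delta> + d * \<gamma> = 0 \<and> (a + 2 * d) * \<delta> + c * \<gamma> = 0"
proof -
  have F: "frame X Y Z X' Y' Z'" using A by (simp add: adapted_def)
  then have mem: "X \<in> g 0" "Y \<in> g 0" "Z \<in> g 0" "X' \<in> g 1" "Y' \<in> g 1" "Z' \<in> g 1"
    by (auto simp: frame_def)
  let ?t = cubic
  have sym:
    "?t X' Y' X' = ?t X' X' Y'" "?t Y' X' X' = ?t X' X' Y'"
    "?t X' Z' X' = ?t X' X' Z'" "?t Z' X' X' = ?t X' X' Z'"
    "?t Y' X' Y' = ?t X' Y' Y'" "?t Y' Y' X' = ?t X' Y' Y'"
    "?t Z' X' Z' = ?t X' Z' Z'" "?t Z' Z' X' = ?t X' Z' Z'"
    "?t X' Z' Y' = ?t X' Y' Z'" "?t Y' X' Z' = ?t X' Y' Z'" "?t Y' Z' X' = ?t X' Y' Z'"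
    "?t Z' X' Y' = ?t X' Y' Z'" "?t Z' Y' X' = ?t X' Y' Z'"
    "?t Y' Z' Y' = ?t Y' Y' Z'" "?t Z' Y' Y' = ?t Y' Y' Z'"
    "?t Z' Y' Z' = ?t Y' Z' Z'" "?t Z' Z' Y' = ?t Y' Z' Z'"
    using cubic_commute mem by metis+
  note co = adapted_coadjoint[OF A]
  note simps = mem co br_linear_simps B_linear_simps sym
  have Yinv: "a * ?t X' X' X' = 0" "b * ?t X' X' X' = 0"
    "2 * a * ?t X' X' Y' = 0" "2 * b * ?t X' X' Z' = 0"
    "b * ?t X' X' Y' + a * ?t X' X' Z' = 0"
    "3 * a * ?t X' Y' Y' = 0" "3 * b * ?t X' Z' Z' = 0"
    "b * ?t X' Y' Y' + 2 * (a * ?t X' Y' Z') = 0"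
    "a * ?t X' Z' Z' + 2 * (b * ?t X' Y' Z') = 0"
    using cubic_invariant[of Y X' X' Y'] cubic_invariant[of Y X' X' Z']
      cubic_invariant[of Y X' Y' Y'] cubic_invariant[of Y X' Z' Z'] cubic_invariant[of Y X' Y' Z']
      cubic_invariant[of Y Y' Y' Y'] cubic_invariant[of Y Z' Z' Z']
      cubic_invariant[of Y Y' Y' Z'] cubic_invariant[of Y Y' Z' Z']
    by (simp_all add: simps add.commute)
  have Xinv: "b * ?t Y' Z' Z' + d * ?t Z' Z' Z' = 0"
    "a * ?t Y' Z' Z' + c * ?t Z' Z' Z' + 2 * b * ?t Y' Y' Z' + 2 * d * ?t Y' Z' Z' = 0"
    "2 * a * ?t Y' Y' Z' + 2 * c * ?t Y' Z' Z' + b * ?t Y' Y' Y' + d * ?t Y' Y' Z' = 0"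
    "a * ?t Y' Y' Y' + c * ?t Y' Y' Z' = 0"
    using cubic_invariant[of X Z' Z' Z'] cubic_invariant[of X Y' Z' Z']
      cubic_invariant[of X Y' Y' Z'] cubic_invariant[of X Y' Y' Y']
    by (simp_all add: simps; algebra)+
  \<comment> \<open>\<open>br Y\<close> sends \<open>Y'\<close> or \<open>Z'\<close> to
    \<open>X'\<close>, so invariance under \<open>Y\<close> removes every component that involves
    \<open>X'\<close>.\<close>
  have "a = 1 \<and> b = 0 \<or> a = 0 \<and> b = 1" using N by (auto simp: normal_form_def)
  then have X'0: "?t X' X' X' = 0" "?t X' X' Y' = 0" "?t X' X' Z' = 0" "?t X' Y' Y' = 0"
    "?t X' Z' Z' = 0" "?t X' Y' Z' = 0"
    using Yinv by (elim disjE conjE; simp)+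
  \<comment> \<open>For the diagonal form, \<open>X\<close> acts on the component at
    \<open>Y' Y' Z'\<close> with weight \<open>2 + d\<close> up to sign, which is nonzero because
    \<open>norm d \<le> 1\<close>.\<close>
  have YYZ: "?t Y' Y' Z' = 0" "?t Y' Y' Y' = 0"
  proof -
    have "2 + d \<noteq> 0" if "norm d \<le> 1"
    proof
      assume "2 + d = 0"
      then have "d = - 2" by (simp add: add_eq_0_iff)
      then show False using that by simp
    qed
    moreover have "(2 + d) * ?t Y' Y' Z' = 0" if "a = 1" "b = 0" "c = 0"
      using Xinv(3,4) that by (simp add: algebra_simps)
    ultimately show "?t Y' Y' Z' = 0" "?t Y' Y' Y' = 0"
      using N Xinv unfolding normal_form_def by (elim disjE; simp)+
  qed
  define \<gamma> \<delta> where gd: "\<gamma> = ?t Z' Z' Z'" "\<delta> = ?t Y' Z' Z'"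
  have "br X' X' = 0" "br X' Y' = 0" "br X' Z' = 0" "br Y' Y' = 0"
    "br Y' Z' = smult \<delta> Z" "br Z' Z' = smult \<gamma> Z + smult \<delta> Y"
    by (rule frame_even_eqI[OF F]; (intro g_closed br_in_g mem g_zero)?;
        use F in \<open>simp add: X'0 YYZ sym gd frame_def B_linear_simps\<close>)+
  moreover have "b * \<delta> + d * \<gamma> = 0" "(a + 2 * d) * \<delta> + c * \<gamma> = 0"
    using Xinv(1,2) YYZ by (simp_all add: gd algebra_simps)
  ultimately show ?thesis using A unfolding adapted_cubic_def by blast
qed

text \<open>The odd vectors scale inversely to their even partners, so \<gamma>, attached to
  \<open>Z' Z' Z'\<close>, is divided by \<open>s ^ 3\<close>, and \<delta>, attached to
  \<open>Y' Z' Z'\<close>, by \<open>p * s\<^sup>2\<close>.\<close>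

lemma adapted_cubic_rescale:
  assumes A: "adapted_cubic X Y Z X' Y' Z' a b c d \<gamma> \<delta>" and nz: "t \<noteq> 0" "p \<noteq> 0" "s \<noteq> 0"
  shows "adapted_cubic (smult t X) (smult p Y) (smult s Z)
    (smult (1 / t) X') (smult (1 / p) Y') (smult (1 / s) Z')
    (t * a) (t * p * b / s) (t * s * c / p) (t * d) (\<gamma> / s ^ 3) (\<delta> / (p * s\<^sup>2))"
proof -
  have "frame (smult t X) (smult p Y) (smult s Z)
      (smult (1 / t) X') (smult (1 / p) Y') (smult (1 / s) Z')"
    using A nz by (simp add: adapted_cubic_def adapted_def frame_def g_closed B_linear_simps)
  then show ?thesis
    using A nz by (simp add: adapted_cubic_def adapted_def br_linear_simps scale_right_distrib
        power2_eq_square power3_eq_cube mult.commute mult.left_commute)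
qed

end

subsection \<open>The model algebras\<close>

lemma all_basis6: "(\<forall>i. P i) \<longleftrightarrow> P X0 \<and> P Y0 \<and> P Z0 \<and> P X1 \<and> P Y1 \<and> P Z1"
  by (metis basis6.exhaust)

lemma space6_eq_iff:
  "v = w \<longleftrightarrow> v $ X0 = w $ X0 \<and> v $ Y0 = w $ Y0 \<and> v $ Z0 = w $ Z0 \<and>
    v $ X1 = w $ X1 \<and> v $ Y1 = w $ Y1 \<and> v $ Z1 = w $ Z1" for v w :: space6
  by (simp add: vec_eq_iff all_basis6)

lemma part6_iff:
  "v \<in> part6 0 \<longleftrightarrow> v $ X1 = 0 \<and> v $ Y1 = 0 \<and> v $ Z1 = 0"
  "v \<in> part6 1 \<longleftrightarrow> v $ X0 = 0 \<and> v $ Y0 = 0 \<and> v $ Z0 = 0"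
  by (simp_all add: part6_def all_basis6)

lemma bracket6_Nil [simp]: "bracket6 [] v w = 0"
  by (simp add: bracket6_def basis_bracket_def)

text \<open>Peels off one table entry, so that the bracket of a concrete table reduces to
  coordinates. An entry with \<open>i = j\<close> counts once, hence the case distinction.\<close>

lemma bracket6_Cons [simp]:
  "bracket6 ((i, j, u) # T) v w =
    (v $ i * w $ j - (if i = j then 0 else koszul (parity i) (parity j) * (v $ j * w $ i))) *s u +
    bracket6 T v w"
proof -
  let ?k = "koszul (parity i) (parity j)"
  \<comment> \<open>The direct and the swapped contribution of the entry; nesting the conditionals
    lets each sum collapse to a single term.\<close>
  define e1 :: "basis6 \<Rightarrow> basis6 \<Rightarrow> space6"
    where "e1 p q = (if p = i then if q = j then u else 0 else 0)" for p q
  define e2 :: "basis6 \<Rightarrow> basis6 \<Rightarrow> space6"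
    where "e2 p q = (if p = j then if q = i then if i = j then 0 else ?k *s u else 0 else 0)" for p q
  have "basis_bracket ((i, j, u) # T) p q = e1 p q - e2 p q + basis_bracket T p q" for p q
  proof -
    have "basis_bracket ((i, j, u) # T) p q =
        (if p = i \<and> q = j then u else if p = j \<and> q = i then - (?k *s u) else 0) + basis_bracket T p q"
      by (simp only: basis_bracket_def list.map sum_list.Cons prod.case)
    moreover have "(if p = i \<and> q = j then u else if p = j \<and> q = i then - (?k *s u) else 0) = e1 p q - e2 p q"
      by (cases "p = i"; cases "q = j"; cases "i = j"; simp add: e1_def e2_def)
    ultimately show ?thesis by simp
  qed
  then have "bracket6 ((i, j, u) # T) v w =
      (\<Sum>p\<in>UNIV. \<Sum>q\<in>UNIV. (v $ p * w $ q) *s e1 p q) -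
      (\<Sum>p\<in>UNIV. \<Sum>q\<in>UNIV. (v $ p * w $ q) *s e2 p q) + bracket6 T v w"
    by (simp add: bracket6_def vec.scale_right_distrib vec.scale_right_diff_distrib
        sum.distrib sum_subtractf)
  also have "(\<Sum>p\<in>UNIV. \<Sum>q\<in>UNIV. (v $ p * w $ q) *s e1 p q) = (v $ i * w $ j) *s u"
  proof -
    have "(\<Sum>q\<in>UNIV. (v $ p * w $ q) *s e1 p q) = (if p = i then (v $ i * w $ j) *s u else 0)" for p
      by (cases "p = i") (simp_all add: e1_def if_distrib[of "\<lambda>x. _ *s x"] cong: if_cong)
    then show ?thesis by simp
  qed
  also have "(\<Sum>p\<in>UNIV. \<Sum>q\<in>UNIV. (v $ p * w $ q) *s e2 p q)
      = (if i = j then 0 else ?k * (v $ j * w $ i)) *s u"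
  proof -
    have "(\<Sum>q\<in>UNIV. (v $ p * w $ q) *s e2 p q)
        = (if p = j then (if i = j then 0 else ?k * (v $ j * w $ i)) *s u else 0)" for p
      by (cases "p = j"; cases "i = j")
        (simp_all add: e2_def if_distrib[of "\<lambda>x. _ *s x"] mult.commute cong: if_cong)
    then show ?thesis by simp
  qed
  finally show ?thesis
    by (simp add: vec.scale_left_diff_distrib)
qed

text \<open>All tables of the classification arise from one family: \<open>a, b, c, d\<close> describe the bracket with
  \<open>bas X0\<close> on the even part, the mixed brackets are the coadjoint action, and \<open>\<gamma>, \<delta>\<close> are the
  coefficients of \<open>z\<^sup>3\<close> and \<open>3yz\<^sup>2\<close> in the cubic form.\<close>

definition family_table ::
  "complex \<Rightarrow> complex \<Rightarrow> complex \<Rightarrow> complex \<Rightarrow> complex \<Rightarrow> complex \<Rightarrow> bracket_table" where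
  "family_table a b c d \<gamma> \<delta> =
    [(X0, Y0, a *s bas Y0 + b *s bas Z0), (X0, Z0, c *s bas Y0 + d *s bas Z0),
     (X0, Y1, - (a *s bas Y1) - c *s bas Z1), (X0, Z1, - (b *s bas Y1) - d *s bas Z1),
     (Y0, Y1, a *s bas X1), (Y0, Z1, b *s bas X1), (Z0, Y1, c *s bas X1), (Z0, Z1, d *s bas X1),
     (Z1, Z1, \<gamma> *s bas Z0 + \<delta> *s bas Y0), (Y1, Z1, \<delta> *s bas Z0)]"

abbreviation family_bracket ::
  "complex \<Rightarrow> complex \<Rightarrow> complex \<Rightarrow> complex \<Rightarrow> complex \<Rightarrow> complex \<Rightarrow> space6 \<Rightarrow> space6 \<Rightarrow> space6" where
  "family_bracket a b c d \<gamma> \<delta> \<equiv> bracket6 (family_table a b c d \<gamma> \<delta>)"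

lemma family_bracket_nth:
  fixes v w a b c d \<gamma> \<delta>
  defines "u \<equiv> family_bracket a b c d \<gamma> \<delta> v w"
  shows "u $ X0 = 0"
    "u $ Y0 = a * (v $ X0 * w $ Y0 - v $ Y0 * w $ X0) + c * (v $ X0 * w $ Z0 - v $ Z0 * w $ X0)
       + \<delta> * (v $ Z1 * w $ Z1)"
    "u $ Z0 = b * (v $ X0 * w $ Y0 - v $ Y0 * w $ X0) + d * (v $ X0 * w $ Z0 - v $ Z0 * w $ X0)
       + \<gamma> * (v $ Z1 * w $ Z1) + \<delta> * (v $ Y1 * w $ Z1 + v $ Z1 * w $ Y1)"
    "u $ X1 = a * (v $ Y0 * w $ Y1 - v $ Y1 * w $ Y0) + b * (v $ Y0 * w $ Z1 - v $ Z1 * w $ Y0)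
       + c * (v $ Z0 * w $ Y1 - v $ Y1 * w $ Z0) + d * (v $ Z0 * w $ Z1 - v $ Z1 * w $ Z0)"
    "u $ Y1 = - (a * (v $ X0 * w $ Y1 - v $ Y1 * w $ X0)) - b * (v $ X0 * w $ Z1 - v $ Z1 * w $ X0)"
    "u $ Z1 = - (c * (v $ X0 * w $ Y1 - v $ Y1 * w $ X0)) - d * (v $ X0 * w $ Z1 - v $ Z1 * w $ X0)"
  by (simp_all add: u_def family_table_def axis_def algebra_simps)

text \<open>The brackets agree although the tables differ: the family also lists zero entries and,
  compared with \<open>go67\<close>, takes \<open>Y1\<close> and \<open>Z1\<close> in the other
  order.\<close>

lemma
  bracket6_go62: "bracket6 go62 = family_bracket 0 1 0 0 0 0" and
  bracket6_go63: "bracket6 go63 = family_bracket 0 1 0 0 1 0" and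
  bracket6_go64: "bracket6 go64 = family_bracket 1 0 1 1 0 0" and
  bracket6_go65: "bracket6 (go65 \<gamma>) = family_bracket 1 0 0 0 \<gamma> 0" and
  bracket6_go66: "bracket6 (go66 \<mu>) = family_bracket 1 0 0 \<mu> 0 0" and
  bracket6_go67: "bracket6 go67 = family_bracket 1 0 0 (- 1 / 2) 0 1"
  by (intro ext; simp add: space6_eq_iff family_bracket_nth
      go62_def go63_def go64_def go65_def go66_def go67_def axis_def algebra_simps)+

text \<open>The assumptions express invariance of the cubic form under \<open>bas X0\<close> at the
  places zzz, yzz and yyz; this is what the Jacobi identity with two odd arguments requires.\<close>

lemma odd_quadratic6_family:
  assumes "b * \<delta> + d * \<gamma> = 0" "(a + 2 * d) * \<delta> + c * \<gamma> = 0" "c * \<delta> = 0"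
  shows "odd_quadratic6 (family_table a b c d \<gamma> \<delta>)"
proof (intro odd_quadratic_lie_superalgebra.intro lie_superalgebra.intro
    odd_quadratic_lie_superalgebra_axioms.intro lie_superalgebra_axioms.intro)
  show "vector_space ((*s) :: complex \<Rightarrow> space6 \<Rightarrow> space6)"
    by (rule vec.vector_space_axioms)
  show "\<exists>S. finite S \<and> vec.span S = (UNIV :: space6 set)"
    using vec.finite_Basis vec.span_Basis by blast
  show "vec.subspace (part6 x)" for x
    by (simp add: vec.subspace_def part6_def)
  show "part6 0 \<inter> part6 1 = {0}"
    by (auto simp: part6_iff space6_eq_iff)
  show "\<exists>u\<in>part6 0. \<exists>v\<in>part6 1. w = u + v" for w
  proof (intro bexI)
    show "w = (\<chi> i. if parity i = 0 then w $ i else 0) + (\<chi> i. if parity i = 1 then w $ i else 0)"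
      by (simp add: vec_eq_iff all_basis6)
  qed (simp_all add: part6_iff)
  fix X Y Z :: space6 and x y z
  show "Vector_Spaces.linear (*s) (*s) (family_bracket a b c d \<gamma> \<delta> X)"
    "Vector_Spaces.linear (*s) (*s) (\<lambda>X. family_bracket a b c d \<gamma> \<delta> X Y)"
    by (unfold_locales; simp add: space6_eq_iff family_bracket_nth algebra_simps)+
  show "Vector_Spaces.linear (*s) (*) (form6 X)" "Vector_Spaces.linear (*s) (*) (\<lambda>X. form6 X Y)"
    by (unfold_locales; simp add: form6_def algebra_simps)+
  show "X = 0" if "\<And>Y. form6 X Y = 0"
    using that[of "bas X0"] that[of "bas Y0"] that[of "bas Z0"]
      that[of "bas X1"] that[of "bas Y1"] that[of "bas Z1"]
    by (simp add: space6_eq_iff form6_def axis_def)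
  show "form6 (family_bracket a b c d \<gamma> \<delta> X Y) Z = form6 X (family_bracket a b c d \<gamma> \<delta> Y Z)"
    by (simp add: form6_def family_bracket_nth algebra_simps)
  assume X: "X \<in> part6 x" and Y: "Y \<in> part6 y"
  show "family_bracket a b c d \<gamma> \<delta> X Y \<in> part6 (x + y)"
    using X Y by (cases "x = 0"; cases "y = 0") (simp_all add: part6_iff family_bracket_nth)
  show "family_bracket a b c d \<gamma> \<delta> Y X = - (koszul x y *s family_bracket a b c d \<gamma> \<delta> X Y)"
    using X Y
    by (cases "x = 0"; cases "y = 0")
      (simp_all add: part6_iff family_bracket_nth space6_eq_iff algebra_simps)
  show "form6 Y X = koszul x y * form6 X Y"
    using X Y by (cases "x = 0"; cases "y = 0") (simp_all add: part6_iff form6_def)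
  show "form6 X Y = 0" if "Y \<in> part6 x"
    using X that by (cases "x = 0") (simp_all add: part6_iff form6_def)
  assume Z: "Z \<in> part6 z"
  \<comment> \<open>The assumptions as rewrite rules for the monomials produced by \<open>algebra_simps\<close>.\<close>
  have "\<delta> * b = - (\<gamma> * d)" "\<delta> * a = - (2 * \<delta> * d) - \<gamma> * c" "\<delta> * c = 0"
    using assms by algebra+
  then have reduce: "\<delta> * (b * t) = - (\<gamma> * (d * t))" "\<delta> * (c * t) = 0"
    "\<delta> * (a * t) = - (2 * (\<delta> * (d * t))) - \<gamma> * (c * t)" for t
    by (simp_all flip: mult.assoc add: left_diff_distrib)
  show "family_bracket a b c d \<gamma> \<delta> X (family_bracket a b c d \<gamma> \<delta> Y Z) =
      family_bracket a b c d \<gamma> \<delta> (family_bracket a b c d \<gamma> \<delta> X Y) Z +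
      koszul x y *s family_bracket a b c d \<gamma> \<delta> Y (family_bracket a b c d \<gamma> \<delta> X Z)"
    using X Y Z
    by (cases "x = 0"; cases "y = 0"; cases "z = 0";
        simp add: part6_iff family_bracket_nth space6_eq_iff; (intro conjI)?;
        simp add: algebra_simps reduce)
qed

section \<open>Coordinates in an adapted frame\<close>

context odd_quadratic_dim6
begin

lemma frame_expand:
  assumes F: "frame X Y Z X' Y' Z'"
  shows "v = smult (B v X') X + smult (B v Y') Y + smult (B v Z') Z +
    smult (B v X) X' + smult (B v Y) Y' + smult (B v Z) Z'"
  by (rule frame_eqI[OF F]) (use F in \<open>auto simp: frame_dual[OF F] frame_def B_linear_simps\<close>)

text \<open>Pairing with the dual vectors gives the coordinate map. All brackets of frame vectors
  are known: the even ones from \<open>adapted\<close>, the mixed ones from the coadjoint action,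
  the odd ones from the cubic form.\<close>

lemma i_isomorphic_family:
  assumes A: "adapted_cubic X Y Z X' Y' Z' a b c d \<gamma> \<delta>"
  shows "i_isomorphic smult g br B (*s) part6 (family_bracket a b c d \<gamma> \<delta>) form6"
proof -
  have A': "adapted X Y Z X' Y' Z' a b c d" and F: "frame X Y Z X' Y' Z'"
    using A by (auto simp: adapted_cubic_def adapted_def)
  note mem = F[unfolded frame_def]
  note dual = mem frame_dual[OF F]
  define f :: "'v \<Rightarrow> space6" where "f v = (\<chi> i. case i of X0 \<Rightarrow> B v X' | Y0 \<Rightarrow> B v Y' | Z0 \<Rightarrow> B v Z'
    | X1 \<Rightarrow> B v X | Y1 \<Rightarrow> B v Y | Z1 \<Rightarrow> B v Z)" for v
  define h where "h w = smult (w $ X0) X + smult (w $ Y0) Y + smult (w $ Z0) Z +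
    smult (w $ X1) X' + smult (w $ Y1) Y' + smult (w $ Z1) Z'" for w :: space6
  have hf: "h (f v) = v" for v
    using frame_expand[OF F, of v] by (simp add: h_def f_def)
  have fh: "f (h w) = w" for w
    by (simp add: h_def f_def space6_eq_iff B_linear_simps dual)
  have "Vector_Spaces.linear smult (*s) f"
    unfolding Vector_Spaces.linear_iff
    by (simp add: f_def space6_eq_iff B_linear_simps vector_space_axioms vec.vector_space_axioms)
  moreover have "bij f" using hf fh by (metis bijI')
  moreover have "f ` g x = part6 x" for x
  proof
    show "f ` g x \<subseteq> part6 x"
      using dual B_odd by (cases "x = 0") (auto simp: f_def part6_iff)
    show "part6 x \<subseteq> f ` g x"
    proof
      fix w assume "w \<in> part6 x"
      then have "h w \<in> g x"
        using mem by (cases "x = 0") (simp_all add: h_def part6_iff g_closed)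
      then show "w \<in> f ` g x" using fh by (metis imageI)
    qed
  qed
  moreover have "f (br u v) = family_bracket a b c d \<gamma> \<delta> (f u) (f v)" for u v
  proof -
    have ee: "br X Y = smult a Y + smult b Z" "br X Z = smult c Y + smult d Z" "br Y Z = 0"
      using A' by (auto simp: adapted_def)
    have ee': "br Y X = - br X Y" "br Z X = - br X Z" "br Z Y = - br Y Z"
      "br X X = 0" "br Y Y = 0" "br Z Z = 0"
      using mem br_skew(1) by auto
    note eo = adapted_coadjoint[OF A']
    have oe: "br X' X = - br X X'" "br Y' X = - br X Y'" "br Z' X = - br X Z'"
      "br X' Y = - br Y X'" "br Y' Y = - br Y Y'" "br Z' Y = - br Y Z'"
      "br X' Z = - br Z X'" "br Y' Z = - br Z Y'" "br Z' Z = - br Z Z'"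
      using mem br_skew(1) by auto
    have oo: "br X' X' = 0" "br X' Y' = 0" "br X' Z' = 0" "br Y' Y' = 0"
      "br Y' Z' = smult \<delta> Z" "br Z' Z' = smult \<gamma> Z + smult \<delta> Y"
      using A by (auto simp: adapted_cubic_def)
    have oo': "br Y' X' = br X' Y'" "br Z' X' = br X' Z'" "br Z' Y' = br Y' Z'"
      using mem br_skew(2) by auto
    \<comment> \<open>Checked through the inverse \<open>h\<close>, where both arguments are
      explicit combinations of frame vectors.\<close>
    have "f (br (h p) (h q)) = family_bracket a b c d \<gamma> \<delta> p q" for p q
      by (simp add: space6_eq_iff family_bracket_nth f_def h_def br_linear_simps B_linear_simps
          ee ee' eo oe oo oo' dual) (simp add: algebra_simps)
    then show ?thesis by (metis hf)
  qed
  moreover have "form6 (f u) (f v) = B u v" for u v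
  proof -
    have "B (h p) (h q) = form6 p q" for p q
      by (simp add: h_def form6_def B_linear_simps dual algebra_simps)
    then show ?thesis by (metis hf)
  qed
  ultimately show ?thesis unfolding i_isomorphic_def by blast
qed

subsection \<open>Indecomposability\<close>

text \<open>After splitting both summands into homogeneous components, the sum of the odd ones
  equals an even vector and hence is 0.\<close>

lemma graded_ideal_components:
  assumes I: "graded_ideal I" and J: "graded_ideal J"
    and sum: "\<forall>v. \<exists>a\<in>I. \<exists>b\<in>J. v = a + b" and v: "v \<in> g 0"
  shows "\<exists>u\<in>I \<inter> g 0. v - u \<in> J \<inter> g 0"
proof -
  obtain a b where ab: "a \<in> I" "b \<in> J" "v = a + b" using sum by blast
  obtain a0 a1 where a: "a0 \<in> I \<inter> g 0" "a1 \<in> I \<inter> g 1" "a = a0 + a1"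
    using I ab(1) unfolding graded_ideal_def by blast
  obtain b0 b1 where b: "b0 \<in> J \<inter> g 0" "b1 \<in> J \<inter> g 1" "b = b0 + b1"
    using J ab(2) unfolding graded_ideal_def by blast
  have "v - a0 - b0 \<in> g 0" using v a b by (intro g_closed) auto
  moreover have "v - a0 - b0 = a1 + b1" using a b ab by simp
  moreover have "a1 + b1 \<in> g 1" using a b by (intro g_closed) auto
  ultimately have "v - a0 - b0 = 0" using g_inter by (metis IntI singletonD)
  then show ?thesis using a b by auto
qed

text \<open>Such an ideal is purely odd, so it is orthogonal to itself by oddness and to
  \<open>J\<close> by assumption; non-degeneracy leaves only 0.\<close>

lemma graded_ideal_trivial_if_no_even_part:
  assumes I: "graded_ideal I" and "I \<inter> g 0 = {0}"
    and sum: "\<forall>v. \<exists>a\<in>I. \<exists>b\<in>J. v = a + b" and orth: "\<forall>a\<in>I. \<forall>b\<in>J. B a b = 0"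
  shows "I = {0}"
proof -
  have odd: "I \<subseteq> g 1"
    using I assms(2) unfolding graded_ideal_def by fastforce
  have "v = 0" if "v \<in> I" for v
  proof (rule eq_if_B_eq)
    fix w
    obtain a b where "a \<in> I" "b \<in> J" "w = a + b" using sum by blast
    then show "B v w = B 0 w"
      using that odd orth B_odd[of v 1 a] by (auto simp: B_add_right)
  qed
  moreover have "0 \<in> I" using I by (simp add: graded_ideal_def subspace_0)
  ultimately show ?thesis by blast
qed

lemma indecomposable_if_normal_form:
  assumes A: "adapted X Y Z X' Y' Z' a b c d" and N: "normal_form a b c d"
    and nz: "b \<noteq> 0 \<or> d \<noteq> 0"
  shows indecomposable
  unfolding indecomposable_def
proof (intro allI impI, elim conjE)
  fix I J
  assume I: "graded_ideal I" and J: "graded_ideal J" and disj: "I \<inter> J = {0}"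
    and sum: "\<forall>v. \<exists>a\<in>I. \<exists>b\<in>J. v = a + b" and orth: "\<forall>a\<in>I. \<forall>b\<in>J. B a b = 0"
  have sum': "\<forall>v. \<exists>b\<in>J. \<exists>a\<in>I. v = b + a"
    using sum by (metis add.commute)
  have orth': "\<forall>b\<in>J. \<forall>a\<in>I. B b a = 0" using orth by (metis B_commute)
  have F: "frame X Y Z X' Y' Z'" using A by (simp add: adapted_def)
  then have mem: "X \<in> g 0" "Y \<in> g 0" "Z \<in> g 0" by (auto simp: frame_def)
  have br: "br X Y = smult a Y + smult b Z" "br X Z = smult c Y + smult d Z" "br Y Z = 0"
    "br Y X = - (smult a Y + smult b Z)" "br Z X = - (smult c Y + smult d Z)" "br Z Y = 0"
    using A br_skew(1)[of X Y 0] br_skew(1)[of X Z 0] br_skew(1)[of Y Z 0] mem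
    by (simp_all add: adapted_def)
  have sI: "subspace I" and sJ: "subspace J" using I J by (auto simp: graded_ideal_def)
  have idI: "br u v \<in> I" if "v \<in> I" for u v using I that by (auto simp: graded_ideal_def)
  have idJ: "br u v \<in> J" if "v \<in> J" for u v using J that by (auto simp: graded_ideal_def)
  \<comment> \<open>The projection \<open>P\<close> of the even part onto \<open>I\<close> commutes with all \<open>br u\<close>; this forces it to be a scalar.\<close>
  obtain P where P: "\<And>v. v \<in> g 0 \<Longrightarrow> P v \<in> I \<and> P v \<in> g 0 \<and> v - P v \<in> J"
    using graded_ideal_components[OF I J sum] by (metis IntD1 IntD2)
  have unique: "P v = u" if "v \<in> g 0" "u \<in> I" "v - u \<in> J" for u v
  proof -
    have "P v - u \<in> I" using P[OF that(1)] that sI by (simp add: subspace_diff)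
    moreover have "P v - u = (v - u) - (v - P v)" by simp
    then have "P v - u \<in> J" using P[OF that(1)] that sJ by (metis subspace_diff)
    ultimately show ?thesis using disj by (metis IntI singletonD eq_iff_diff_eq_0)
  qed
  have P_add: "P (u + v) = P u + P v" if "u \<in> g 0" "v \<in> g 0" for u v
  proof (rule unique)
    have "(u - P u) + (v - P v) \<in> J" using P that sJ by (simp add: subspace_add)
    then show "u + v - (P u + P v) \<in> J" by (simp add: algebra_simps)
  qed (use P that sI in \<open>auto simp: subspace_add g_closed\<close>)
  have P_scale: "P (smult k v) = smult k (P v)" if "v \<in> g 0" for k v
  proof (rule unique)
    have "smult k (v - P v) \<in> J" using P that sJ by (simp add: subspace_scale)
    then show "smult k v - smult k (P v) \<in> J" by (simp add: scale_right_diff_distrib)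
  qed (use P that sI in \<open>auto simp: subspace_scale g_closed\<close>)
  have P_0: "P 0 = 0" using unique[of 0 0] sI sJ by (simp add: subspace_0)
  have P_br: "P (br u v) = br u (P v)" if "u \<in> g 0" "v \<in> g 0" for u v
  proof (rule unique)
    show "br u v - br u (P v) \<in> J"
      using idJ[of "v - P v" u] P[OF that(2)] by (simp add: br_diff_right)
  qed (use P that idI in \<open>auto simp: br_in_g\<close>)
  \<comment> \<open>By skew-symmetry \<open>P\<close> also passes to the first argument.\<close>
  have P_br': "P (br u v) = br (P u) v" if "u \<in> g 0" "v \<in> g 0" for u v
  proof -
    have "P (br u v) = P (smult (- 1) (br v u))" using br_skew(1)[of v u 0] that by simp
    also have "\<dots> = - br v (P u)"
      using P_scale[of "br v u" "- 1"] that by (simp add: P_br br_in_g)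
    also have "\<dots> = br (P u) v" using br_skew(1)[of v "P u" 0] P[OF that(1)] that by simp
    finally show ?thesis .
  qed
  have P_P: "P (P v) = P v" if "v \<in> g 0" for v
    using unique[of "P v" "P v"] P[OF that] sJ by (simp add: subspace_0)
  define \<alpha> \<beta> \<gamma> where PX_coeffs: "\<alpha> = B (P X) X'" "\<beta> = B (P X) Y'" "\<gamma> = B (P X) Z'"
  have PX: "P X = smult \<alpha> X + smult \<beta> Y + smult \<gamma> Z"
    unfolding PX_coeffs by (rule frame_even_expand[OF F]) (use P[OF mem(1)] in simp)
  define \<alpha>' \<beta>' \<gamma>' where PY_coeffs: "\<alpha>' = B (P Y) X'" "\<beta>' = B (P Y) Y'" "\<gamma>' = B (P Y) Z'"
  have PY: "P Y = smult \<alpha>' X + smult \<beta>' Y + smult \<gamma>' Z"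
    unfolding PY_coeffs by (rule frame_even_expand[OF F]) (use P[OF mem(2)] in simp)
  note dual = F[unfolded frame_def]
  note coords = arg_cong[where f = "\<lambda>v. B v X'"] arg_cong[where f = "\<lambda>v. B v Y'"]
    arg_cong[where f = "\<lambda>v. B v Z'"]
  \<comment> \<open>\<open>P\<close> maps \<open>br X X = 0\<close> to \<open>br (P X) X\<close>, so
    \<open>P X\<close> commutes with \<open>X\<close>.\<close>
  have "br (P X) X = 0" using P_br'[of X X] mem by (simp add: P_0)
  from coords(2,3)[OF this] have PX_X: "a * \<beta> + c * \<gamma> = 0" "b * \<beta> + d * \<gamma> = 0"
    by (simp_all add: PX br_linear_simps B_linear_simps br mem dual) algebra+
  have "P X = smult \<alpha> X \<and> P Y = smult \<alpha> Y \<and> P Z = smult \<alpha> Z"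
  proof (cases "b = 1")
    case True
    then have [simp]: "a = 0" "b = 1" "c = 0" "d = 0" using N by (auto simp: normal_form_def)
    have "\<beta> = 0" using PX_X by simp
    then have PX': "P X = smult \<alpha> X + smult \<gamma> Z" using PX by simp
    have "br (P Y) Y = 0" using P_br'[of Y Y] mem by (simp add: P_0)
    from coords(3)[OF this] have "\<alpha>' = 0"
      by (simp add: PY br_linear_simps B_linear_simps br mem dual)
    have PZ: "P Z = smult \<alpha> Z"
      using P_br'[of X Y] mem by (simp add: PX' br br_linear_simps)
    moreover have "P Z = smult \<beta>' Z"
      using P_br[of X Y] mem by (simp add: PY \<open>\<alpha>' = 0\<close> br br_linear_simps)
    ultimately have "smult \<alpha> Z = smult \<beta>' Z" by metis
    then have "B (smult \<alpha> Z) Z' = B (smult \<beta>' Z) Z'" by (rule arg_cong)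
    then have "\<alpha> = \<beta>'" by (simp add: B_linear_simps dual)
    then have PY': "P Y = smult \<alpha> Y + smult \<gamma>' Z" using PY \<open>\<alpha>' = 0\<close> by simp
    \<comment> \<open>Commuting with brackets leaves multiples of the central \<open>Z\<close> in
      \<open>P X\<close> and \<open>P Y\<close>; idempotence of \<open>P\<close> removes them, since
      \<alpha> is 0 or 1.\<close>
    have PPX: "smult \<alpha> (P X) + smult \<gamma> (P Z) = P X"
      using P_P[OF mem(1)] mem by (simp add: PX' P_add P_scale g_closed)
    have PPY: "smult \<alpha> (P Y) + smult \<gamma>' (P Z) = P Y"
      using P_P[OF mem(2)] mem by (simp add: PY' P_add P_scale g_closed)
    have "\<alpha> * \<alpha> = \<alpha>" "2 * \<alpha> * \<gamma> = \<gamma>" "2 * \<alpha> * \<gamma>' = \<gamma>'"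
      using coords(1,3)[OF PPX] coords(3)[OF PPY] by (simp_all add: PX' PY' PZ B_linear_simps dual)
    then have "\<gamma> = 0 \<and> \<gamma>' = 0" by (cases "\<alpha> = 0") auto
    with PX' PY' PZ show ?thesis by simp
  next
    case False
    \<comment> \<open>Here \<open>nz\<close> gives \<open>d \<noteq> 0\<close>, so
      \<open>br X\<close> is invertible on the plane of \<open>Y\<close> and \<open>Z\<close>, and
      \<open>P X\<close>, commuting with \<open>X\<close>, is a multiple of
      \<open>X\<close>.\<close>
    then have [simp]: "a = 1" "b = 0" and "d \<noteq> 0" using N nz by (auto simp: normal_form_def)
    then have "\<gamma> = 0" "\<beta> = 0" using PX_X by auto
    then have PX': "P X = smult \<alpha> X" using PX by simp
    have PY': "P Y = smult \<alpha> Y"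
      using P_br'[of X Y] mem by (simp add: PX' br br_linear_simps)
    have "smult c (P Y) + smult d (P Z) = smult \<alpha> (smult c Y + smult d Z)"
      using P_br'[of X Z] mem by (simp add: PX' br br_linear_simps P_add P_scale g_closed)
    then have "smult d (P Z) = smult d (smult \<alpha> Z)"
      by (simp add: PY' scale_right_distrib mult.commute)
    then have "P Z = smult \<alpha> Z" using \<open>d \<noteq> 0\<close> by (simp only: scale_left_imp_eq)
    then show ?thesis using PX' PY' by simp
  qed
  then have eq: "P v = smult \<alpha> v" if "v \<in> g 0" for v
  proof -
    define x y z where xyz: "x = B v X'" "y = B v Y'" "z = B v Z'"
    have v: "v = smult x X + smult y Y + smult z Z"
      unfolding xyz by (rule frame_even_expand[OF F that])
    show ?thesis
      using mem \<open>P X = smult \<alpha> X \<and> P Y = smult \<alpha> Y \<and> P Z = smult \<alpha> Z\<close>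
      by (simp add: v P_add P_scale g_closed scale_right_distrib mult.commute)
  qed
  \<comment> \<open>The scalar is idempotent: 0 leaves \<open>I\<close> without even part, and 1
    leaves \<open>J\<close> without even part.\<close>
  have "smult (\<alpha> * \<alpha>) X = smult \<alpha> X"
    using P_P[OF mem(1)] mem by (simp add: eq g_closed)
  then have "B (smult (\<alpha> * \<alpha>) X) X' = B (smult \<alpha> X) X'" by (rule arg_cong)
  then have "\<alpha> = 0 \<or> \<alpha> = 1" using F by (simp add: frame_def B_linear_simps)
  then show "I = {0} \<or> J = {0}"
  proof
    assume "\<alpha> = 0"
    then have "P v = 0" if "v \<in> g 0" for v using eq[OF that] by simp
    moreover have "P v = v" if "v \<in> I" "v \<in> g 0" for v
      using unique[of v v] that sJ by (simp add: subspace_0)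
    ultimately have "I \<inter> g 0 = {0}" using sI by (force simp: subspace_0)
    then show ?thesis
      using graded_ideal_trivial_if_no_even_part[OF I _ sum orth] by blast
  next
    assume "\<alpha> = 1"
    then have "P v = v" if "v \<in> g 0" for v using eq[OF that] by simp
    moreover have "P v = 0" if "v \<in> J" "v \<in> g 0" for v
      using unique[of v 0] that sI by (simp add: subspace_0)
    ultimately have "J \<inter> g 0 = {0}" using sJ by (force simp: subspace_0)
    then show ?thesis
      using graded_ideal_trivial_if_no_even_part[OF J _ sum' orth'] by blast
  qed
qed

end

subsection \<open>The classification\<close>

lemma complex_cube_root_exists: "\<exists>s::complex. s ^ 3 = z"
proof
  have "rcis (root 3 (cmod z)) (Arg z / 3) ^ 3 = rcis (cmod z) (Arg z)"
    by (simp add: DeMoivre2)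
  then show "rcis (root 3 (cmod z)) (Arg z / 3) ^ 3 = z"
    by (simp add: rcis_cmod_Arg)
qed

context odd_quadratic_dim6
begin

lemma classification:
  assumes "solvable" "br_sets (g 0) (g 0) \<noteq> {0}"
  shows "i_isomorphic smult g br B (*s) part6 (bracket6 go62) form6 \<or>
    i_isomorphic smult g br B (*s) part6 (bracket6 go63) form6 \<or>
    i_isomorphic smult g br B (*s) part6 (bracket6 go64) form6 \<or>
    (\<exists>\<gamma>. i_isomorphic smult g br B (*s) part6 (bracket6 (go65 \<gamma>)) form6) \<or>
    (\<exists>\<mu>. \<mu> \<noteq> 0 \<and> norm \<mu> \<le> 1 \<and>
      i_isomorphic smult g br B (*s) part6 (bracket6 (go66 \<mu>)) form6) \<or>
    i_isomorphic smult g br B (*s) part6 (bracket6 go67) form6"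
proof -
  \<comment> \<open>The zero matrix would make all even frame vectors commute, against the
    assumption on the even part.\<close>
  have "\<not> has_type 0 0 0 0"
  proof
    assume "has_type 0 0 0 0"
    then obtain X Y Z X' Y' Z' where A: "adapted X Y Z X' Y' Z' 0 0 0 0"
      by (auto simp: has_type_def)
    then have F: "frame X Y Z X' Y' Z'" and mem: "X \<in> g 0" "Y \<in> g 0" "Z \<in> g 0"
      and "br X Y = 0" "br X Z = 0" "br Y Z = 0"
      by (auto simp: adapted_def frame_def)
    moreover from this have "br Y X = 0" "br Z X = 0" "br Z Y = 0"
      using br_skew(1)[of X Y 0] br_skew(1)[of X Z 0] br_skew(1)[of Y Z 0] by simp_all
    ultimately have *: "br (smult x X + smult y Y + smult z Z) (smult x' X + smult y' Y + smult z' Z) = 0"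
      for x y z x' y' z'
      by (simp add: br_linear_simps)
    have "br u v = 0" if "u \<in> g 0" "v \<in> g 0" for u v
      using * frame_even_expand[OF F that(1)] frame_even_expand[OF F that(2)] by metis
    with assms(2) show False by (simp add: br_sets_eq_0_iff)
  qed
  then obtain a b c d where "has_type a b c d" and N: "normal_form a b c d"
    using has_type_if_solvable[OF assms(1)] has_type_normal_form by blast
  then obtain X Y Z X' Y' Z' where A: "adapted X Y Z X' Y' Z' a b c d"
    by (auto simp: has_type_def)
  obtain \<gamma> \<delta> where C: "adapted_cubic X Y Z X' Y' Z' a b c d \<gamma> \<delta>"
    and eqs: "b * \<delta> + d * \<gamma> = 0" "(a + 2 * d) * \<delta> + c * \<gamma> = 0"
    using adapted_cubic_if_normal_form[OF A N] by blast
  consider (heisenberg) "(a, b, c, d) = (0, 1, 0, 0)" | (jordan) "(a, b, c, d) = (1, 0, 1, 1)"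
    | (diagonal) "(a, b, c) = (1, 0, 0)" "norm d \<le> 1"
    using N by (auto simp: normal_form_def)
  then show ?thesis
  proof cases
    case heisenberg
    then have [simp]: "a = 0" "b = 1" "c = 0" "d = 0" "\<delta> = 0" using eqs by auto
    show ?thesis
    proof (cases "\<gamma> = 0")
      case True
      then show ?thesis using i_isomorphic_family[OF C] by (simp add: bracket6_go62)
    next
      case False
      \<comment> \<open>Scaling \<open>X\<close> and \<open>Z\<close> by \<open>s\<close> and
        keeping \<open>Y\<close> preserves \<open>b = 1\<close> and divides \<gamma> by
        \<open>s ^ 3\<close>.\<close>
      obtain s where s: "s ^ 3 = \<gamma>" using complex_cube_root_exists by blast
      then have "s \<noteq> 0" using False by auto
      then show ?thesis
        using i_isomorphic_family[OF adapted_cubic_rescale[OF C, of s 1 s]] False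
        by (simp add: s bracket6_go63)
    qed
  next
    case jordan
    then have [simp]: "a = 1" "b = 0" "c = 1" "d = 1" by auto
    then have "\<gamma> = 0" "\<delta> = 0" using eqs by auto
    then show ?thesis using i_isomorphic_family[OF C] by (simp add: bracket6_go64)
  next
    case diagonal
    then have [simp]: "a = 1" "b = 0" "c = 0" by auto
    show ?thesis
    proof (cases "d = 0")
      case True
      then have "\<delta> = 0" using eqs by simp
      then have "i_isomorphic smult g br B (*s) part6 (bracket6 (go65 \<gamma>)) form6"
        using i_isomorphic_family[OF C] True by (simp add: bracket6_go65)
      then show ?thesis by blast
    next
      case False
      then have "\<gamma> = 0" using eqs by simp
      show ?thesis
      proof (cases "\<delta> = 0")
        case True
        then have "i_isomorphic smult g br B (*s) part6 (bracket6 (go66 d)) form6"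
          using i_isomorphic_family[OF C] \<open>\<gamma> = 0\<close> by (simp add: bracket6_go66)
        then show ?thesis using False diagonal by blast
      next
        case \<delta>: False
        \<comment> \<open>A nonzero \<delta> forces the weight \<open>1 + 2 * d\<close> of the
          monomial yzz to vanish; scaling \<open>Y\<close> by \<delta> then makes the coefficient
          1.\<close>
        then have "1 + 2 * d = 0" using eqs(2) by simp
        then have "d = - 1 / 2" by algebra
        then show ?thesis
          using i_isomorphic_family[OF adapted_cubic_rescale[OF C, of 1 \<delta> 1]] \<delta> \<open>\<gamma> = 0\<close>
          by (simp add: bracket6_go67)
      qed
    qed
  qed
qed

end

text \<open>The standard basis of a model is itself an adapted frame, so the criterion for normal
  forms applies to it.\<close>

lemma indecomposable6_family:
  assumes "b * \<delta> + d * \<gamma> = 0" "(a + 2 * d) * \<delta> + c * \<gamma> = 0" "c * \<delta> = 0"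
    and "b \<noteq> 0 \<or> d \<noteq> 0"
    and N: "(a, b, c, d) = (0, 1, 0, 0) \<or> (a, b, c, d) = (1, 0, 1, 1) \<or>
      (a, b, c) = (1, 0, 0) \<and> norm d \<le> 1"
  shows "indecomposable6 (family_table a b c d \<gamma> \<delta>)"
proof -
  interpret odd_quadratic_lie_superalgebra "(*s)" part6 "family_bracket a b c d \<gamma> \<delta>" form6
    by (rule odd_quadratic6_family[OF assms(1-3)])
  have "card (UNIV :: basis6 set) = 6" by (simp add: UNIV_basis6)
  then have "vec.dim (UNIV :: space6 set) = 6" by (simp add: card_cart_basis)
  then interpret odd_quadratic_dim6 "(*s)" part6 "family_bracket a b c d \<gamma> \<delta>" form6
    by unfold_locales
  have "adapted (bas X0) (bas Y0) (bas Z0) (bas X1) (bas Y1) (bas Z1) a b c d"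
    by (simp add: adapted_def frame_def part6_iff form6_def space6_eq_iff family_bracket_nth axis_def)
  then show ?thesis
    using indecomposable_if_normal_form N assms(4) unfolding normal_form_def by blast
qed

theorem mainTheorem9:
  fixes smult :: "complex \<Rightarrow> 'v::ab_group_add \<Rightarrow> 'v"
    and g :: "bit \<Rightarrow> 'v set"
    and br :: "'v \<Rightarrow> 'v \<Rightarrow> 'v"
    and B :: "'v \<Rightarrow> 'v \<Rightarrow> complex"
  shows
    "(odd_quadratic_lie_superalgebra smult g br B \<and>
      lie_superalgebra.solvable smult br \<and>
      vector_space.dim smult (UNIV :: 'v set) = 6 \<longrightarrow>
        (lie_superalgebra.br_sets smult br (g 0) (g 0) = {0} \<longrightarrow>
           lie_superalgebra.br_sets smult br (g 0) (g 1) = {0} \<and>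
           (\<forall>a\<in>g 0. \<forall>b\<in>g 1. \<forall>c\<in>g 0. \<forall>d\<in>g 1. br (a + b) (c + d) = br b d \<and> br b d \<in> g 0)) \<and>
        (lie_superalgebra.br_sets smult br (g 0) (g 0) \<noteq> {0} \<longrightarrow>
           i_isomorphic smult g br B (*s) part6 (bracket6 go62) form6 \<or>
           i_isomorphic smult g br B (*s) part6 (bracket6 go63) form6 \<or>
           i_isomorphic smult g br B (*s) part6 (bracket6 go64) form6 \<or>
           (\<exists>\<gamma>. i_isomorphic smult g br B (*s) part6 (bracket6 (go65 \<gamma>)) form6) \<or>
           (\<exists>\<mu>. \<mu> \<noteq> 0 \<and> norm \<mu> \<le> 1 \<and>
                i_isomorphic smult g br B (*s) part6 (bracket6 (go66 \<mu>)) form6) \<or>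
           i_isomorphic smult g br B (*s) part6 (bracket6 go67) form6)) \<and>
     odd_quadratic6 go62 \<and> odd_quadratic6 go63 \<and> odd_quadratic6 go64 \<and>
     (\<forall>\<gamma>. odd_quadratic6 (go65 \<gamma>)) \<and>
     (\<forall>\<mu>. \<mu> \<noteq> 0 \<and> norm \<mu> \<le> 1 \<longrightarrow> odd_quadratic6 (go66 \<mu>)) \<and>
     odd_quadratic6 go67 \<and>
     indecomposable6 go62 \<and> indecomposable6 go63 \<and> indecomposable6 go64 \<and>
     (\<forall>\<mu>. \<mu> \<noteq> 0 \<and> norm \<mu> \<le> 1 \<longrightarrow> indecomposable6 (go66 \<mu>)) \<and>
     indecomposable6 go67"
    (is "(?quadratic \<and> ?solvable \<and> ?dim6 \<longrightarrow> (?abelian \<longrightarrow> ?trivial) \<and> (?nonabelian \<longrightarrow> ?models)) \<and> _")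
proof (intro conjI)
  show "odd_quadratic6 go62" "odd_quadratic6 go63" "odd_quadratic6 go64" "odd_quadratic6 go67"
    "\<forall>\<gamma>. odd_quadratic6 (go65 \<gamma>)"
    "\<forall>\<mu>. \<mu> \<noteq> 0 \<and> norm \<mu> \<le> 1 \<longrightarrow> odd_quadratic6 (go66 \<mu>)"
    by (simp_all add: bracket6_go62 bracket6_go63 bracket6_go64 bracket6_go65 bracket6_go66
        bracket6_go67 odd_quadratic6_family)
  show "indecomposable6 go62" "indecomposable6 go63" "indecomposable6 go64" "indecomposable6 go67"
    "\<forall>\<mu>. \<mu> \<noteq> 0 \<and> norm \<mu> \<le> 1 \<longrightarrow> indecomposable6 (go66 \<mu>)"
    by (simp_all add: bracket6_go62 bracket6_go63 bracket6_go64 bracket6_go66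
        bracket6_go67 indecomposable6_family)
  show "?quadratic \<and> ?solvable \<and> ?dim6 \<longrightarrow> (?abelian \<longrightarrow> ?trivial) \<and> (?nonabelian \<longrightarrow> ?models)"
  proof (intro impI conjI; elim conjE)
    assume "odd_quadratic_lie_superalgebra smult g br B"
    then interpret odd_quadratic_lie_superalgebra smult g br B .
    assume "br_sets (g 0) (g 0) = {0}"
    then have ee: "br X Y = 0" if "X \<in> g 0" "Y \<in> g 0" for X Y
      using that by (simp add: br_sets_eq_0_iff)
    then have eo: "br X Y = 0" if "X \<in> g 0" "Y \<in> g 1" for X Y
      using that br_even_odd_eq_0_if_abelian by blast
    then show "br_sets (g 0) (g 1) = {0}" by (simp add: br_sets_eq_0_iff)
    show "\<forall>a\<in>g 0. \<forall>b\<in>g 1. \<forall>c\<in>g 0. \<forall>d\<in>g 1. br (a + b) (c + d) = br b d \<and> br b d \<in> g 0"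
    proof (intro ballI conjI)
      fix a b c d assume abcd: "a \<in> g 0" "b \<in> g 1" "c \<in> g 0" "d \<in> g 1"
      then show "br (a + b) (c + d) = br b d"
        using br_skew(1)[of c b 1] by (simp add: br_linear_simps ee eo)
      show "br b d \<in> g 0" using abcd by (simp add: br_in_g)
    qed
  next
    assume "odd_quadratic_lie_superalgebra smult g br B"
      "vector_space.dim smult (UNIV :: 'v set) = 6"
    then interpret odd_quadratic_dim6 smult g br B
      by (intro odd_quadratic_dim6.intro odd_quadratic_dim6_axioms.intro)
    assume "solvable" "br_sets (g 0) (g 0) \<noteq> {0}"
    then show ?models
      by (rule classification)
  qed
qed

end
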